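(* Let $\omega\in(0,2\pi]$ and let $\Omega=\{(r\cos\varphi,r\sin\varphi)\in\mathbb{R}^2: 0<r<1,\ 0<\varphi<\omega\}$. Let $k\in\mathbb{N}_0$ and $m\in\mathbb{N}$, put $\nu_k=k\frac{\pi}{\omega}$, and let $u_{\nu_k,m}$ be the Laplace eigenfunction of the circular sector $\Omega$ given in polar coordinates by $$u_{\nu_k,m}(r,\varphi)=J_{\nu_k}(\mu_{\nu_k,m}\,r)\cos(\nu_k\varphi),$$ where $\mu_{\nu_k,m}$ is the $m$-th positive root of the Bessel function $J_{\nu_k}$. Then $$u_{\nu_k,m}\in H^s(\Omega)\quad\text{for all } s\ge 0$$ if and only if $\nu_k=k\frac{\pi}{\omega}\in\mathbb{N}_0$. Moreover, if $\nu_k\notin\mathbb{N}_0$, then the regularity result "$u_{\nu_k,m}\in H^s(\Omega)$ for all $s\ge 0$ with $s<\nu_k+1$" is sharp, that is, $u_{\nu_k,m}\notin H^s(\Omega)$ for all $s\ge\nu_k+1$.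
   Context: $\mathbb{N}=\{1,2,\dots\}$ and $\mathbb{N}_0=\mathbb{N}\cup\{0\}$. $J_\nu$ denotes the Bessel function of the first kind of order $\nu\ge 0$, $J_\nu(z)=\sum_{j=0}^\infty \frac{(-1)^j}{j!\,\Gamma(\nu+j+1)}\left(\frac z2\right)^{2j+\nu}$ for $z\geq 0$, and its positive roots are numbered in increasing order, $\mu_{\nu,1}<\mu_{\nu,2}<\dots$. The functions $u_{\nu_k,m}$ are the eigenfunctions of $-\Delta$ on $\Omega$ with homogeneous Dirichlet conditions on the circular arc $\{r=1\}$ and homogeneous Neumann conditions on the two straight legs $\varphi\in\{0,\omega\}$, with eigenvalue $\mu_{\nu_k,m}^2$ (normalization constant equal to $1$). For $s\in\mathbb{N}_0$, $H^s(\Omega)$ is the classical $L^2$-based Sobolev space, with $H^0(\Omega)=L^2(\Omega)$; for $s\ge 0$ with $s\notin\mathbb{N}_0$, $H^s(\Omega)$ denotes the Sobolev–Slobodeckij space. *)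

theory Defs
  imports "HOL-Analysis.Analysis"
begin

subsection \<open>Bessel functions of the first kind and their positive roots\<close>

text \<open>
  The case distinction is needed because \<open>0 powr 0 = 0\<close>, whereas the constant term of
  \<open>J\<^sub>0\<close> is \<open>1\<close>.
\<close>

definition bessel_J :: "real \<Rightarrow> real \<Rightarrow> real" where
  "bessel_J \<nu> z = (\<Sum>j. (-1) ^ j / (fact j * Gamma (\<nu> + real j + 1)) *
     (if 2 * real j + \<nu> = 0 then 1 else (z / 2) powr (2 * real j + \<nu>)))"

text \<open>
  For \<open>m \<ge> 1\<close>: \<open>x\<close> is the \<open>m\<close>-th positive root in increasing order. (For \<open>m = 0\<close> the
  condition would say that the roots in \<open>{0<..x}\<close> are infinitely many.)
\<close>

definition is_nth_positive_root :: "(real \<Rightarrow> real) \<Rightarrow> nat \<Rightarrow> real \<Rightarrow> bool" where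
  "is_nth_positive_root f m x \<longleftrightarrow>
     0 < x \<and> f x = 0 \<and> card {y. 0 < y \<and> y \<le> x \<and> f y = 0} = m"


subsection \<open>Weak derivatives\<close>

definition partial_deriv ::
    "'a::euclidean_space \<Rightarrow> ('a \<Rightarrow> real) \<Rightarrow> 'a \<Rightarrow> real" where
  "partial_deriv b f x = frechet_derivative f (at x) b"

text \<open>
  A multi-index of order \<open>n\<close> is represented by a list of \<open>n\<close> basis vectors. For smooth
  functions the order of the entries is irrelevant, so this gives the same derivatives as the
  usual multi-indices.
\<close>

definition partial_derivs ::
    "'a::euclidean_space list \<Rightarrow> ('a \<Rightarrow> real) \<Rightarrow> 'a \<Rightarrow> real" where
  "partial_derivs bs f = foldr partial_deriv bs f"

definition smooth :: "('a::euclidean_space \<Rightarrow> real) \<Rightarrow> bool" where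
  "smooth f \<longleftrightarrow> (\<forall>bs \<in> lists Basis. \<forall>x. partial_derivs bs f differentiable (at x))"

definition test_functions :: "'a::euclidean_space set \<Rightarrow> ('a \<Rightarrow> real) set" where
  "test_functions \<Omega> = {\<phi>. smooth \<phi> \<and> compact (closure {x. \<phi> x \<noteq> 0}) \<and>
     closure {x. \<phi> x \<noteq> 0} \<subseteq> \<Omega>}"

definition L2_on :: "'a::euclidean_space set \<Rightarrow> ('a \<Rightarrow> real) set" where
  "L2_on \<Omega> = {u \<in> borel_measurable (lebesgue_on \<Omega>).
     integrable (lebesgue_on \<Omega>) (\<lambda>x. (u x)\<^sup>2)}"

text \<open>
  Used only for \<open>u\<close> and \<open>v\<close> in \<open>L2_on \<Omega>\<close>, so that both integrands are integrable.
\<close>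

definition is_weak_deriv ::
    "'a::euclidean_space set \<Rightarrow> 'a list \<Rightarrow> ('a \<Rightarrow> real) \<Rightarrow> ('a \<Rightarrow> real) \<Rightarrow> bool" where
  "is_weak_deriv \<Omega> bs u v \<longleftrightarrow> (\<forall>\<phi> \<in> test_functions \<Omega>.
     (LINT x|lebesgue_on \<Omega>. u x * partial_derivs bs \<phi> x) =
     (-1) ^ length bs * (LINT x|lebesgue_on \<Omega>. v x * \<phi> x))"


subsection \<open>Sobolev and Sobolev--Slobodeckij spaces\<close>

definition sobolev :: "nat \<Rightarrow> 'a::euclidean_space set \<Rightarrow> ('a \<Rightarrow> real) set" where
  "sobolev n \<Omega> = {u \<in> L2_on \<Omega>. \<forall>bs \<in> lists Basis. length bs \<le> n \<longrightarrow>
     (\<exists>v \<in> L2_on \<Omega>. is_weak_deriv \<Omega> bs u v)}"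

text \<open>
  The square of the Slobodeckij seminorm of order \<open>\<sigma> \<in> (0,1)\<close>. The integrand vanishes on the
  diagonal, since division by zero yields zero.
\<close>

definition slobodeckij_energy ::
    "real \<Rightarrow> 'a::euclidean_space set \<Rightarrow> ('a \<Rightarrow> real) \<Rightarrow> ennreal" where
  "slobodeckij_energy \<sigma> \<Omega> v =
     (\<integral>\<^sup>+x. (\<integral>\<^sup>+y. ennreal ((v x - v y)\<^sup>2 / dist x y powr (real DIM('a) + 2 * \<sigma>))
        \<partial>lebesgue_on \<Omega>) \<partial>lebesgue_on \<Omega>)"

text \<open>
  The space \<open>H\<^sup>s(\<Omega>)\<close> for real \<open>s \<ge> 0\<close>. Weak derivatives are unique almost everywhere and the
  energy does not depend on the representative, so the choice of \<open>v\<close> is immaterial.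
\<close>

definition sobolev_slobodeckij ::
    "real \<Rightarrow> 'a::euclidean_space set \<Rightarrow> ('a \<Rightarrow> real) set" where
  "sobolev_slobodeckij s \<Omega> = {u \<in> sobolev (nat \<lfloor>s\<rfloor>) \<Omega>.
     s \<notin> \<nat> \<longrightarrow> (\<forall>bs \<in> lists Basis. length bs = nat \<lfloor>s\<rfloor> \<longrightarrow>
       (\<exists>v \<in> L2_on \<Omega>. is_weak_deriv \<Omega> bs u v \<and>
          slobodeckij_energy (s - of_int \<lfloor>s\<rfloor>) \<Omega> v < \<infinity>))}"


subsection \<open>Circular sectors\<close>

definition sector :: "real \<Rightarrow> (real \<times> real) set" where
  "sector \<omega> = {(r * cos \<phi>, r * sin \<phi>) | r \<phi>. 0 < r \<and> r < 1 \<and> 0 < \<phi> \<and> \<phi> < \<omega>}"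

end

theory Submission
  imports Defs
begin

text \<open>
  In polar coordinates \<open>u = r\<^sup>\<nu> cos (\<nu>\<phi>) G(r\<^sup>2)\<close> with an entire function \<open>G\<close> and
  \<open>G(0) \<noteq> 0\<close>. For a natural number \<open>\<nu>\<close> the factor \<open>r\<^sup>\<nu> cos (\<nu>\<phi>)\<close> is the polynomial
  \<open>Re (z\<^sup>\<nu>)\<close>, so \<open>u\<close> extends smoothly to the plane.

  For \<open>\<nu> \<notin> \<nat>\<close> let \<open>N = \<lfloor>\<nu>\<rfloor>\<close> and test the \<open>(N + 2)\<close>-nd \<open>x\<close>-derivative against the
  rescaled bumps \<open>\<psi>(k x)\<close>. Substituting \<open>y = k x\<close> shows that \<open>\<integral> u \<partial>\<^sub>x\<^bsup>N+2\<^esup> \<psi>(k\<sqdot>)\<close> is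
  \<open>k\<^bsup>N-\<nu>\<^esup>\<close> times a quantity with limit \<open>I = G(0) \<integral> Re (z\<^sup>\<nu>) \<partial>\<^sub>x\<^bsup>N+2\<^esup> \<psi>\<close>. Integrating by
  parts, \<open>I\<close> is a nonzero multiple of \<open>\<integral> Re (z\<^bsup>\<nu>-N-2\<^esup>) \<psi> > 0\<close>. A weak derivative of order \<open>N + 2\<close>
  in \<open>L\<^sup>2\<close> would make the same integral \<open>O(1/k)\<close>. A weak derivative of order \<open>N + 1\<close> with finite
  energy of order \<open>\<sigma> \<ge> \<nu> - N\<close>, tested against the mean-zero function \<open>\<partial>\<^sub>x \<psi>(k\<sqdot>)\<close>, would make it
  \<open>o(k\<^bsup>-\<sigma>\<^esup>)\<close>. Both are impossible.
\<close>

subsection \<open>An algebra of smooth functions\<close>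

lemma partial_deriv_eq:
  assumes "(f has_derivative D) (at x)"
  shows "partial_deriv b f x = D b"
  using frechet_derivative_at[OF assms] by (simp add: partial_deriv_def)

text \<open>The function t^(-n) exp(-1/t), extended by 0. The whole family in \<open>n\<close> is
  introduced at once because the derivative of a member is a combination of members.\<close>

definition flat_exp :: "nat \<Rightarrow> real \<Rightarrow> real" where
  "flat_exp n t = (if t \<le> 0 then 0 else inverse t ^ n * exp (- inverse t))"

lemma flat_exp_tendsto_0: "(flat_exp n \<longlongrightarrow> 0) (at_right 0)"
proof -
  have "((\<lambda>t. inverse t ^ n / exp (inverse t)) \<longlongrightarrow> (0::real)) (at_right 0)"
    by (rule filterlim_compose[OF tendsto_power_div_exp_0 filterlim_inverse_at_top_right])
  then show ?thesis
    by (rule Lim_transform_eventually)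
       (auto simp: eventually_at_filter flat_exp_def exp_minus divide_simps)
qed

text \<open>Away from 0 this is the product rule. At 0 the right difference quotient of
  \<open>flat_exp n\<close> is \<open>flat_exp (Suc n)\<close>, which tends to 0 because the
  exponential beats every power.\<close>

lemma flat_exp_has_derivative:
  "(flat_exp n has_real_derivative (flat_exp (n + 2) t - real n * flat_exp (n + 1) t)) (at t)"
proof -
  consider "t < 0" | "t = 0" | "0 < t" by linarith
  then show ?thesis
  proof cases
    case 1
    have "((\<lambda>_. 0) has_real_derivative 0) (at t)" by simp
    then have "(flat_exp n has_real_derivative 0) (at t)"
      by (rule has_field_derivative_transform_within_open[of _ _ _ "{..<0}"])
         (use 1 in \<open>auto simp: flat_exp_def\<close>)
    then show ?thesis using 1 by (simp add: flat_exp_def)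
  next
    case 2
    have "((\<lambda>h. flat_exp n h / h) \<longlongrightarrow> 0) (at_right 0)"
      by (rule Lim_transform_eventually[OF flat_exp_tendsto_0[of "Suc n"]])
         (auto simp: eventually_at_filter flat_exp_def field_simps)
    moreover have "((\<lambda>h. flat_exp n h / h) \<longlongrightarrow> 0) (at_left 0)"
      by (rule Lim_transform_eventually[OF tendsto_const])
         (auto simp: eventually_at_filter flat_exp_def)
    ultimately have "((\<lambda>h. flat_exp n h / h) \<longlongrightarrow> 0) (at 0)"
      by (simp add: filterlim_at_split)
    then show ?thesis
      using 2 by (simp add: DERIV_def flat_exp_def[of _ 0])
  next
    case 3
    have "((\<lambda>t. inverse t ^ n * exp (- inverse t)) has_real_derivative
            (inverse t ^ (n + 2) * exp (- inverse t)
             - real n * (inverse t ^ (n + 1) * exp (- inverse t)))) (at t)"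
    proof -
      have i: "(inverse has_real_derivative - (inverse t ^ 2)) (at t)"
        using DERIV_inverse[of t] 3 by (simp add: numeral_2_eq_2)
      show ?thesis
        by (rule DERIV_cong[OF DERIV_mult[OF DERIV_power[OF i, of n] DERIV_fun_exp[OF DERIV_minus[OF i]]]])
           (cases n; simp add: algebra_simps power2_eq_square)
    qed
    then have "(flat_exp n has_real_derivative
            (inverse t ^ (n + 2) * exp (- inverse t)
             - real n * (inverse t ^ (n + 1) * exp (- inverse t)))) (at t)"
      by (rule has_field_derivative_transform_within_open[of _ _ _ "{0<..}"])
         (use 3 in \<open>auto simp: flat_exp_def\<close>)
    then show ?thesis using 3 by (simp add: flat_exp_def)
  qed
qed

text \<open>
  The generators are chosen so that the set is closed under partial derivatives and contains both
  the explicit form of the eigenfunction for integral order and smooth bump functions.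
\<close>

inductive_set smooth_alg :: "('a::euclidean_space \<Rightarrow> real) set" where
  const: "(\<lambda>_. c) \<in> smooth_alg"
| inner: "(\<lambda>x. x \<bullet> a) \<in> smooth_alg"
| add: "f \<in> smooth_alg \<Longrightarrow> g \<in> smooth_alg \<Longrightarrow> (\<lambda>x. f x + g x) \<in> smooth_alg"
| mult: "f \<in> smooth_alg \<Longrightarrow> g \<in> smooth_alg \<Longrightarrow> (\<lambda>x. f x * g x) \<in> smooth_alg"
| flat_exp: "f \<in> smooth_alg \<Longrightarrow> (\<lambda>x. flat_exp n (f x)) \<in> smooth_alg"
| power_series: "(\<And>t. summable (\<lambda>n. c n * t ^ n)) \<Longrightarrow> f \<in> smooth_alg \<Longrightarrow>
    (\<lambda>x. \<Sum>n. c n * f x ^ n) \<in> smooth_alg"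

lemma smooth_alg_diff:
  assumes "f \<in> smooth_alg" "g \<in> smooth_alg"
  shows "(\<lambda>x. f x - g x) \<in> smooth_alg"
  using smooth_alg.add[OF assms(1) smooth_alg.mult[OF smooth_alg.const[of "-1"] assms(2)]] by simp

text \<open>The derivative is carried through the induction together with the membership of its
  directional components. This closes the algebra under partial derivatives, so every member is
  differentiable to all orders.\<close>

lemma smooth_alg_has_derivative:
  assumes "f \<in> smooth_alg"
  shows "\<exists>D. (\<forall>x. (f has_derivative D x) (at x)) \<and> (\<forall>b. (\<lambda>x. D x b) \<in> smooth_alg)"
  using assms
proof induction
  case (const c)
  show ?case by (rule exI[of _ "\<lambda>_ _. 0"]) (auto intro: smooth_alg.const)
next
  case (inner a)
  show ?case
    by (rule exI[of _ "\<lambda>_ h. h \<bullet> a"]) (auto intro: smooth_alg.const derivative_eq_intros)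
next
  case (add f g)
  then obtain D E where "\<forall>x. (f has_derivative D x) (at x)" "\<forall>b. (\<lambda>x. D x b) \<in> smooth_alg"
     "\<forall>x. (g has_derivative E x) (at x)" "\<forall>b. (\<lambda>x. E x b) \<in> smooth_alg" by auto
  then show ?case
    by (intro exI[of _ "\<lambda>x h. D x h + E x h"]) (auto intro: smooth_alg.add has_derivative_add)
next
  case (mult f g)
  then obtain D E where *: "\<forall>x. (f has_derivative D x) (at x)" "\<forall>b. (\<lambda>x. D x b) \<in> smooth_alg"
     "\<forall>x. (g has_derivative E x) (at x)" "\<forall>b. (\<lambda>x. E x b) \<in> smooth_alg" by auto
  then show ?case
    by (intro exI[of _ "\<lambda>x h. f x * E x h + D x h * g x"])
       (auto intro!: smooth_alg.add smooth_alg.mult mult.hyps has_derivative_mult)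
next
  case (flat_exp f n)
  then obtain D where *: "\<And>x. (f has_derivative D x) (at x)" "\<forall>b. (\<lambda>x. D x b) \<in> smooth_alg"
    by auto
  have "((\<lambda>x. flat_exp n (f x)) has_derivative
     (\<lambda>h. (flat_exp (n + 2) (f x) - real n * flat_exp (n + 1) (f x)) * D x h)) (at x)" for x
    by (rule has_derivative_compose[OF *(1)]) (rule has_field_derivative_imp_has_derivative[OF flat_exp_has_derivative])
  then show ?case
    using flat_exp.hyps *(2)
    by (intro exI[of _ "\<lambda>x h. (flat_exp (n + 2) (f x) - real n * flat_exp (n + 1) (f x)) * D x h"])
       (auto intro!: smooth_alg.mult smooth_alg_diff smooth_alg.const smooth_alg.flat_exp)
next
  case (power_series c f)
  then obtain D where *: "\<And>x. (f has_derivative D x) (at x)" "\<forall>b. (\<lambda>x. D x b) \<in> smooth_alg"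
    by auto
  have "((\<lambda>x. \<Sum>n. c n * f x ^ n) has_derivative
     (\<lambda>h. (\<Sum>n. diffs c n * f x ^ n) * D x h)) (at x)" for x
    by (rule has_derivative_compose[OF *(1)])
       (rule has_field_derivative_imp_has_derivative,
        rule termdiffs_strong_converges_everywhere[OF power_series.hyps(1)])
  moreover have "summable (\<lambda>n. diffs c n * t ^ n)" for t
    by (rule termdiff_converges_all[OF power_series.hyps(1)])
  ultimately show ?case
    using power_series.hyps *(2)
    by (intro exI[of _ "\<lambda>x h. (\<Sum>n. diffs c n * f x ^ n) * D x h"])
       (auto intro!: smooth_alg.mult smooth_alg.power_series)
qed

section \<open>Iterated partial derivatives, supports and test functions\<close>

lemma partial_derivs_Nil [simp]: "partial_derivs [] f = f"
  and partial_derivs_Cons: "partial_derivs (b # bs) f = partial_deriv b (partial_derivs bs f)"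
  and partial_derivs_append: "partial_derivs (as @ bs) f = partial_derivs as (partial_derivs bs f)"
  by (simp_all add: partial_derivs_def)

lemma smooth_alg_differentiable: "f \<in> smooth_alg \<Longrightarrow> f differentiable (at x)"
  using smooth_alg_has_derivative[of f] by (auto simp: differentiable_def)

lemma smooth_alg_partial_deriv:
  assumes "f \<in> smooth_alg"
  shows "partial_deriv b f \<in> smooth_alg"
proof -
  obtain D where D: "\<And>x. (f has_derivative D x) (at x)" "\<And>b. (\<lambda>x. D x b) \<in> smooth_alg"
    using smooth_alg_has_derivative[OF assms] by blast
  have "partial_deriv b f = (\<lambda>x. D x b)"
    using partial_deriv_eq[OF D(1)] by auto
  with D(2) show ?thesis by simp
qed

lemma smooth_alg_partial_derivs: "f \<in> smooth_alg \<Longrightarrow> partial_derivs bs f \<in> smooth_alg"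
  by (induction bs) (auto simp: partial_derivs_Cons intro: smooth_alg_partial_deriv)

lemma smooth_alg_smooth: "f \<in> smooth_alg \<Longrightarrow> smooth f"
  by (simp add: smooth_def smooth_alg_differentiable smooth_alg_partial_derivs)

lemma smooth_differentiable:
  assumes "smooth f" "bs \<in> lists Basis"
  shows "partial_derivs bs f differentiable (at x)"
  using assms by (auto simp: smooth_def)

lemma smooth_partial_derivs:
  assumes "smooth f" "bs \<in> lists Basis"
  shows "smooth (partial_derivs bs f)"
  using assms by (auto simp: smooth_def simp flip: partial_derivs_append)

lemma smooth_continuous_on:
  assumes "smooth f" shows "continuous_on S f"
  using smooth_differentiable[OF assms, of "[]"]
  by (auto intro!: continuous_at_imp_continuous_on differentiable_imp_continuous_within)

lemma partial_deriv_eq_0: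
  assumes "x \<notin> closure {x. f x \<noteq> 0}"
  shows "partial_deriv b f x = 0"
proof -
  have "((\<lambda>_. 0) has_derivative (\<lambda>_. 0)) (at x)" by simp
  then have "(f has_derivative (\<lambda>_. 0)) (at x)"
    by (rule has_derivative_transform_within_open[of _ _ _ _ "- closure {x. f x \<noteq> 0}"])
       (use assms closure_subset[of "{x. f x \<noteq> 0}"] in auto)
  then show ?thesis by (simp add: partial_deriv_eq)
qed

lemma closure_support_partial_derivs:
  "closure {x. partial_derivs bs f x \<noteq> 0} \<subseteq> closure {x. f x \<noteq> 0}"
proof (induction bs)
  case (Cons b bs)
  have "{x. partial_derivs (b # bs) f x \<noteq> 0} \<subseteq> closure {x. partial_derivs bs f x \<noteq> 0}"
    using partial_deriv_eq_0 by (fastforce simp: partial_derivs_Cons)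
  with Cons show ?case
    by (meson closed_closure closure_minimal order_trans)
qed simp

lemma test_functions_partial_derivs:
  assumes "\<phi> \<in> test_functions \<Omega>" "bs \<in> lists Basis"
  shows "partial_derivs bs \<phi> \<in> test_functions \<Omega>"
proof -
  note sub = closure_support_partial_derivs[of bs \<phi>]
  have "compact (closure {x. partial_derivs bs \<phi> x \<noteq> 0})"
    using assms(1) bounded_subset[OF compact_imp_bounded sub]
    by (simp add: test_functions_def compact_eq_bounded_closed)
  then show ?thesis
    using assms sub by (auto simp: test_functions_def smooth_partial_derivs)
qed

subsection \<open>Integration by parts\<close>

text \<open>The open sets \<open>G\<close> and \<open>- S\<close> cover the space. The intended use
  is a product of a factor that is continuous only on \<open>G\<close>, such as a real power on a
  half-plane, with a factor supported in \<open>S\<close>.\<close>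

lemma continuous_on_UNIV_glue:
  fixes f :: "'a::topological_space \<Rightarrow> 'b::{topological_space,zero}"
  assumes "open G" "closed S" "S \<subseteq> G" "continuous_on G f" "\<And>x. x \<notin> S \<Longrightarrow> f x = 0"
  shows "continuous_on UNIV f"
proof -
  have "continuous_on (- S) f"
    using continuous_on_cong[of "- S" "- S" "\<lambda>_. 0" f] assms(5) by simp
  then have "continuous_on (G \<union> - S) f"
    using assms by (intro continuous_on_open_Un) auto
  moreover have "G \<union> - S = UNIV" using assms(3) by auto
  ultimately show ?thesis by simp
qed

lemma integrable_compact_support:
  fixes f :: "'a::euclidean_space \<Rightarrow> real"
  assumes "compact S" "continuous_on UNIV f" "\<And>x. x \<notin> S \<Longrightarrow> f x = 0"
  shows "integrable lborel f"
proof -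
  have "integrable lborel (\<lambda>x. indicator S x *\<^sub>R f x)"
    by (rule borel_integrable_compact[OF assms(1) continuous_on_subset[OF assms(2)]]) simp
  also have "(\<lambda>x. indicator S x *\<^sub>R f x) = f"
    using assms(3) by (intro ext) (auto split: split_indicator)
  finally show ?thesis .
qed

lemma bounded_compact_support:
  fixes f :: "'a::topological_space \<Rightarrow> real"
  assumes "compact S" "continuous_on UNIV f" "\<And>x. x \<notin> S \<Longrightarrow> f x = 0"
  shows "\<exists>B>0. \<forall>x. \<bar>f x\<bar> \<le> B"
proof -
  have "bounded (f ` S)"
    by (intro compact_imp_bounded compact_continuous_image continuous_on_subset[OF assms(2)] assms(1)) simp
  then obtain B where "B > 0" "\<And>x. x \<in> S \<Longrightarrow> \<bar>f x\<bar> \<le> B"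
    by (auto simp: bounded_pos)
  with assms(3) show ?thesis by (metis abs_zero less_imp_le)
qed

lemma integral_lborel_translate:
  fixes f :: "'a::euclidean_space \<Rightarrow> real"
  assumes "integrable lborel f"
  shows "integrable lborel (\<lambda>x. f (c + x))" "integral\<^sup>L lborel (\<lambda>x. f (c + x)) = integral\<^sup>L lborel f"
proof -
  have [measurable]: "f \<in> borel_measurable borel" using assms by auto
  have m: "(+) c \<in> lborel \<rightarrow>\<^sub>M borel" by simp
  show "integrable lborel (\<lambda>x. f (c + x))"
    using integrable_distr_eq[OF m, of f] assms by (simp add: lborel_distr_plus)
  show "integral\<^sup>L lborel (\<lambda>x. f (c + x)) = integral\<^sup>L lborel f"
    using integral_distr[OF m, of f] by (simp add: lborel_distr_plus)
qed

lemma integral_lborel_scale: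
  fixes f :: "'a::euclidean_space \<Rightarrow> real"
  assumes "c > 0" and [measurable]: "f \<in> borel_measurable borel"
  shows "integral\<^sup>L lborel f = c ^ DIM('a) * integral\<^sup>L lborel (\<lambda>x. f (c *\<^sub>R x))"
proof -
  have "integral\<^sup>L lborel f
     = integral\<^sup>L (density (distr lborel borel (\<lambda>x. 0 + c *\<^sub>R x)) (\<lambda>_. ennreal (\<bar>c\<bar>^DIM('a)))) f"
    using lborel_affine[of c "0::'a"] assms(1) by simp
  also have "\<dots> = c ^ DIM('a) * integral\<^sup>L lborel (\<lambda>x. f (c *\<^sub>R x))"
    using assms(1) by (simp add: integral_density integral_distr)
  finally show ?thesis .
qed

lemma has_derivative_line:
  assumes "f differentiable (at (x + t *\<^sub>R b))"
  shows "((\<lambda>t. f (x + t *\<^sub>R b)) has_real_derivative partial_deriv b f (x + t *\<^sub>R b)) (at t)"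
proof -
  have "(f has_derivative frechet_derivative f (at (x + t *\<^sub>R b))) (at (x + t *\<^sub>R b))"
    using assms by (simp add: frechet_derivative_works)
  moreover have "((\<lambda>t. x + t *\<^sub>R b) has_derivative (\<lambda>h. h *\<^sub>R b)) (at t)"
    by (auto intro!: derivative_eq_intros)
  ultimately have "((\<lambda>t. f (x + t *\<^sub>R b)) has_derivative
      (\<lambda>h. frechet_derivative f (at (x + t *\<^sub>R b)) (h *\<^sub>R b))) (at t)"
    by (rule has_derivative_compose[rotated])
  then show ?thesis
    unfolding has_field_derivative_def partial_deriv_def
    using linear_frechet_derivative[OF assms] by (simp add: linear_cmul mult_commute_abs)
qed

text \<open>
  By translation invariance the difference quotients of \<open>h\<close> have integral zero; no iterated
  integration is needed.
\<close>

lemma integral_partial_deriv_eq_0: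
  fixes h :: "'a::euclidean_space \<Rightarrow> real"
  assumes diff: "\<And>x. h differentiable (at x)" and cont: "continuous_on UNIV (partial_deriv b h)"
    and S: "compact S" and zero: "\<And>x. x \<notin> S \<Longrightarrow> h x = 0"
  shows "integral\<^sup>L lborel (partial_deriv b h) = 0"
proof -
  have conth: "continuous_on UNIV h"
    using diff by (simp add: continuous_at_imp_continuous_on differentiable_imp_continuous_within)
  have "{x. h x \<noteq> 0} \<subseteq> S" using zero by auto
  then have "closure {x. h x \<noteq> 0} \<subseteq> S"
    using S by (simp add: closure_minimal compact_imp_closed)
  then have zero': "partial_deriv b h x = 0" if "x \<notin> S" for x
    using that by (auto intro: partial_deriv_eq_0)
  obtain B where B: "B > 0" "\<And>x. \<bar>partial_deriv b h x\<bar> \<le> B"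
    using bounded_compact_support[OF S cont zero'] by blast
  obtain R where R: "\<And>x. x \<in> S \<Longrightarrow> norm x \<le> R"
    using S by (meson bounded_iff compact_imp_bounded)
  \<comment> \<open>The shifts have length at most \<open>norm b\<close>, so \<open>K\<close>
    contains the supports of all difference quotients \<open>s i\<close> and can carry one
    dominating function.\<close>
  define K where "K = cball (0::'a) (R + norm b)"
  define s where "s = (\<lambda>i x. real (Suc i) * (h (inverse (real (Suc i)) *\<^sub>R b + x) - h x))"
  have int: "integrable lborel h" by (rule integrable_compact_support[OF S conth zero])
  have int0: "integral\<^sup>L lborel (s i) = 0" for i
    using integral_lborel_translate[OF int] int by (simp add: s_def)
  have "(\<lambda>i. integral\<^sup>L lborel (s i)) \<longlonglongrightarrow> integral\<^sup>L lborel (partial_deriv b h)"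
  proof (rule integral_dominated_convergence[where w = "\<lambda>x. B * indicator K x"])
    show "partial_deriv b h \<in> borel_measurable lborel"
      using cont by (simp add: borel_measurable_continuous_onI)
    show "s i \<in> borel_measurable lborel" for i
      using integral_lborel_translate(1)[OF int] int unfolding s_def by simp
    show "integrable lborel (\<lambda>x. B * indicator K x)"
      unfolding K_def by (auto intro!: emeasure_compact_finite)
    have "(\<lambda>i. s i x) \<longlonglongrightarrow> partial_deriv b h x" for x
    proof -
      have "((\<lambda>t. (h (x + t *\<^sub>R b) - h x) / t) \<longlongrightarrow> partial_deriv b h x) (at 0)"
        using has_derivative_line[of h x 0 b] diff by (simp add: DERIV_def)
      moreover have "filterlim (\<lambda>i. inverse (real (Suc i))) (at 0) sequentially"
        using LIMSEQ_inverse_real_of_nat by (simp add: filterlim_at)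
      ultimately have "(\<lambda>i. (h (x + inverse (real (Suc i)) *\<^sub>R b) - h x) / inverse (real (Suc i)))
          \<longlonglongrightarrow> partial_deriv b h x"
        by (rule filterlim_compose)
      moreover have "s i x = (h (x + inverse (real (Suc i)) *\<^sub>R b) - h x) / inverse (real (Suc i))" for i
        unfolding s_def by (subst add.commute) (simp add: divide_inverse mult.commute)
      ultimately show ?thesis by simp
    qed
    then show "AE x in lborel. (\<lambda>i. s i x) \<longlonglongrightarrow> partial_deriv b h x" by simp
    have "norm (s i x) \<le> B * indicator K x" for i x
    proof (cases "x \<in> K")
      case True
      let ?t = "inverse (real (Suc i))"
      \<comment> \<open>By the mean value theorem each difference quotient is a value of the
        derivative, so \<open>B\<close> bounds it independently of \<open>i\<close>.\<close>
      have "\<exists>z. z > 0 \<and> z < ?t \<and> h (x + ?t *\<^sub>R b) - h (x + 0 *\<^sub>R b)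
          = (?t - 0) * partial_deriv b h (x + z *\<^sub>R b)"
        by (rule MVT2) (auto intro: has_derivative_line diff)
      then obtain z where "h (x + ?t *\<^sub>R b) - h x = ?t * partial_deriv b h (x + z *\<^sub>R b)"
        by auto
      then have "s i x = partial_deriv b h (x + z *\<^sub>R b)"
        by (simp add: s_def add.commute)
      then show ?thesis using True B by simp
    next
      case False
      have "x \<notin> S" using R[of x] False by (auto simp: K_def intro: add_increasing2)
      moreover have "inverse (real (Suc i)) *\<^sub>R b + x \<notin> S"
      proof
        assume "inverse (real (Suc i)) *\<^sub>R b + x \<in> S"
        then have "norm (inverse (real (Suc i)) *\<^sub>R b + x) \<le> R" by (rule R)
        moreover have "norm x \<le> norm (inverse (real (Suc i)) *\<^sub>R b + x) + norm (inverse (real (Suc i)) *\<^sub>R b)"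
          by (metis add_diff_cancel_left' norm_triangle_ineq4)
        moreover have "norm (inverse (real (Suc i)) *\<^sub>R b) \<le> 1 * norm b"
          unfolding norm_scaleR by (rule mult_right_mono) (auto simp: divide_simps inverse_eq_divide)
        ultimately show False using False by (simp add: K_def)
      qed
      ultimately show ?thesis using False zero by (simp add: s_def)
    qed
    then show "AE x in lborel. norm (s i x) \<le> B * indicator K x" for i by simp
  qed
  then show ?thesis using int0 by (simp add: LIMSEQ_const_iff)
qed

text \<open>The derivative of the product \<open>f x * g x\<close> has integral zero.
  Differentiability of \<open>f\<close> on \<open>G\<close> suffices: the product vanishes on the
  open set \<open>- S\<close>, hence is differentiable everywhere.\<close>

lemma integration_by_parts:
  fixes f g :: "'a::euclidean_space \<Rightarrow> real"
  assumes "open G" and f: "\<And>x. x \<in> G \<Longrightarrow> f differentiable (at x)"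
    and f': "continuous_on G (partial_deriv b f)"
    and g: "\<And>x. g differentiable (at x)" and g': "continuous_on UNIV (partial_deriv b g)"
    and S: "compact S" "S \<subseteq> G" and zero: "\<And>x. x \<notin> S \<Longrightarrow> g x = 0"
  shows "integral\<^sup>L lborel (\<lambda>x. f x * partial_deriv b g x) = - integral\<^sup>L lborel (\<lambda>x. partial_deriv b f x * g x)"
proof -
  have cS: "closed S" using S by (simp add: compact_imp_closed)
  have sub: "closure {x. g x \<noteq> 0} \<subseteq> S"
    using zero by (intro closure_minimal cS) auto
  then have zero': "partial_deriv b g x = 0" if "x \<notin> S" for x
    using that by (auto intro: partial_deriv_eq_0)
  have cf: "continuous_on G f" and cg: "continuous_on UNIV g"
    using f g by (auto intro!: continuous_at_imp_continuous_on differentiable_imp_continuous_within)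
  note cg' = continuous_on_subset[OF cg subset_UNIV] continuous_on_subset[OF g' subset_UNIV]
  have c1: "continuous_on UNIV (\<lambda>x. f x * partial_deriv b g x)"
    by (rule continuous_on_UNIV_glue[OF \<open>open G\<close> cS S(2)])
       (use zero' in \<open>auto intro!: continuous_intros cf cg'\<close>)
  have c2: "continuous_on UNIV (\<lambda>x. partial_deriv b f x * g x)"
    by (rule continuous_on_UNIV_glue[OF \<open>open G\<close> cS S(2)])
       (use zero in \<open>auto intro!: continuous_intros f' cg'\<close>)
  note i1 = integrable_compact_support[OF S(1) c1] and i2 = integrable_compact_support[OF S(1) c2]
  define h where "h x = f x * g x" for x
  have h: "(h has_derivative (\<lambda>v. f x * frechet_derivative g (at x) v + frechet_derivative f (at x) v * g x)) (at x)"
    if "x \<in> G" for x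
    unfolding h_def using f[OF that] g by (intro has_derivative_mult) (auto simp: frechet_derivative_works)
  have h': "(h has_derivative (\<lambda>v. 0)) (at x)" if "x \<notin> S" for x
    by (rule has_derivative_transform_within_open[of "\<lambda>_. 0" _ _ _ "- S"])
       (use that cS zero in \<open>auto simp: h_def open_Compl\<close>)
  have dh: "h differentiable (at x)" for x
    using h[of x] h'[of x] S(2) by (auto simp: differentiable_def)
  have eq: "partial_deriv b h = (\<lambda>x. f x * partial_deriv b g x + partial_deriv b f x * g x)"
  proof
    fix x show "partial_deriv b h x = f x * partial_deriv b g x + partial_deriv b f x * g x"
      using partial_deriv_eq[OF h, of x b] partial_deriv_eq[OF h', of x b] S(2) zero[of x] zero'[of x]
      by (cases "x \<in> S") (auto simp: partial_deriv_def)
  qed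
  have "integral\<^sup>L lborel (partial_deriv b h) = 0"
    by (rule integral_partial_deriv_eq_0[OF dh _ S(1)])
       (auto simp: eq h_def zero intro!: continuous_intros c1 c2)
  then show ?thesis using i1 i2 zero zero' by (simp add: eq)
qed

text \<open>Passes from the measure of the definitions to \<open>lborel\<close>, on which
  translations and scalings act. Restriction is harmless as \<open>f\<close> vanishes off
  \<open>\<Omega>\<close>, completion as \<open>f\<close> is Borel.\<close>

lemma integral_lebesgue_on_eq_lborel:
  fixes f :: "'a::euclidean_space \<Rightarrow> real"
  assumes "f \<in> borel_measurable borel" "\<Omega> \<in> sets borel" "\<And>x. x \<notin> \<Omega> \<Longrightarrow> f x = 0"
  shows "integral\<^sup>L (lebesgue_on \<Omega>) f = integral\<^sup>L lborel f"
proof -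
  have "integral\<^sup>L (lebesgue_on \<Omega>) f = integral\<^sup>L lebesgue (\<lambda>x. indicator \<Omega> x *\<^sub>R f x)"
    using assms by (intro integral_restrict_space) auto
  also have "(\<lambda>x. indicator \<Omega> x *\<^sub>R f x) = f"
    using assms(3) by (intro ext) (auto split: split_indicator)
  also have "integral\<^sup>L lebesgue f = integral\<^sup>L lborel f"
    using assms(1) by (intro integral_completion) simp
  finally show ?thesis .
qed

lemma test_functionsD:
  assumes "\<phi> \<in> test_functions \<Omega>"
  shows "smooth \<phi>" "compact (closure {x. \<phi> x \<noteq> 0})" "closure {x. \<phi> x \<noteq> 0} \<subseteq> \<Omega>"
    "\<And>x. x \<notin> closure {x. \<phi> x \<noteq> 0} \<Longrightarrow> \<phi> x = 0"
  using assms closure_subset[of "{x. \<phi> x \<noteq> 0}"] by (auto simp: test_functions_def)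

text \<open>
  Moving the derivatives over one at a time reverses their order, so the symmetry of second
  derivatives is not required.
\<close>

lemma smooth_imp_weak_deriv:
  fixes f :: "'a::euclidean_space \<Rightarrow> real"
  assumes f: "smooth f" and "open \<Omega>" and bs: "bs \<in> lists Basis"
  shows "is_weak_deriv \<Omega> bs f (partial_derivs (rev bs) f)"
  unfolding is_weak_deriv_def
proof
  fix \<phi> :: "'a \<Rightarrow> real" assume \<phi>: "\<phi> \<in> test_functions \<Omega>"
  \<comment> \<open>Covers both sides of the weak-derivative identity: the left one with
    \<open>cs = bs\<close>, the right one with \<open>cs = []\<close>.\<close>
  have bridge: "(LINT x|lebesgue_on \<Omega>. g x * partial_derivs cs \<phi> x)
     = integral\<^sup>L lborel (\<lambda>x. g x * partial_derivs cs \<phi> x)"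
    if "smooth g" "cs \<in> lists Basis" for g cs
  proof (rule integral_lebesgue_on_eq_lborel)
    have t: "partial_derivs cs \<phi> \<in> test_functions \<Omega>"
      by (rule test_functions_partial_derivs[OF \<phi> that(2)])
    show "(\<lambda>x. g x * partial_derivs cs \<phi> x) \<in> borel_measurable borel"
      by (intro borel_measurable_continuous_onI continuous_on_mult
          smooth_continuous_on[OF that(1)] smooth_continuous_on[OF test_functionsD(1)[OF t]])
    show "g x * partial_derivs cs \<phi> x = 0" if "x \<notin> \<Omega>" for x
    proof -
      have "x \<notin> closure {x. partial_derivs cs \<phi> x \<noteq> 0}"
        using that test_functionsD(3)[OF t] by blast
      from test_functionsD(4)[OF t this] show ?thesis by simp
    qed
  qed (use \<open>open \<Omega>\<close> in auto)
  have "integral\<^sup>L lborel (\<lambda>x. f x * partial_derivs bs \<phi> x)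
      = (-1) ^ length bs * integral\<^sup>L lborel (\<lambda>x. partial_derivs (rev bs) f x * \<phi> x)"
    using f bs
  proof (induction bs arbitrary: f)
    case (Cons b bs)
    have t: "partial_derivs bs \<phi> \<in> test_functions \<Omega>" "partial_derivs (b # bs) \<phi> \<in> test_functions \<Omega>"
      using Cons.prems by (auto intro!: test_functions_partial_derivs \<phi>)
    have sf: "smooth (partial_deriv b f)"
      using smooth_partial_derivs[of f "[b]"] Cons.prems by (simp add: partial_derivs_Cons)
    have "integral\<^sup>L lborel (\<lambda>x. f x * partial_deriv b (partial_derivs bs \<phi>) x)
        = - integral\<^sup>L lborel (\<lambda>x. partial_deriv b f x * partial_derivs bs \<phi> x)"
    proof (rule integration_by_parts[of UNIV])
      show "f differentiable at x" for x
        using smooth_differentiable[OF Cons.prems(1), of "[]"] by simp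
      show "partial_derivs bs \<phi> differentiable at x" for x
        using smooth_differentiable[OF test_functionsD(1)[OF t(1)], of "[]"] by simp
      show "continuous_on UNIV (partial_deriv b f)"
        by (rule smooth_continuous_on[OF sf])
      show "continuous_on UNIV (partial_deriv b (partial_derivs bs \<phi>))"
        using smooth_continuous_on[OF test_functionsD(1)[OF t(2)]] by (simp add: partial_derivs_Cons)
      show "compact (closure {x. partial_derivs bs \<phi> x \<noteq> 0})"
        by (rule test_functionsD[OF t(1)])
      show "x \<notin> closure {x. partial_derivs bs \<phi> x \<noteq> 0} \<Longrightarrow> partial_derivs bs \<phi> x = 0" for x
        by (rule test_functionsD(4)[OF t(1)])
    qed auto
    also have "\<dots> = - ((-1) ^ length bs * integral\<^sup>L lborel
        (\<lambda>x. partial_derivs (rev bs) (partial_deriv b f) x * \<phi> x))"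
      using Cons sf by simp
    finally show ?case
      by (simp add: partial_derivs_Cons partial_derivs_append)
  qed simp
  moreover have "smooth (partial_derivs (rev bs) f)"
    using bs by (intro smooth_partial_derivs[OF f]) auto
  ultimately show "(LINT x|lebesgue_on \<Omega>. f x * partial_derivs bs \<phi> x) =
     (-1) ^ length bs * (LINT x|lebesgue_on \<Omega>. partial_derivs (rev bs) f x * \<phi> x)"
    using bridge[OF f bs] bridge[of "partial_derivs (rev bs) f" "[]"] by simp
qed

subsection \<open>Smooth functions have finite Slobodeckij energy\<close>

lemma nn_integral_lebesgue_on_le:
  fixes F :: "'a::euclidean_space \<Rightarrow> ennreal"
  assumes [measurable]: "F \<in> borel_measurable borel" "\<Omega> \<in> sets borel" "K \<in> sets borel" and "\<Omega> \<subseteq> K"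
  shows "(\<integral>\<^sup>+x. F x \<partial>lebesgue_on \<Omega>) \<le> (\<integral>\<^sup>+x. F x * indicator K x \<partial>lborel)"
proof -
  have "(\<integral>\<^sup>+x. F x \<partial>lebesgue_on \<Omega>) = (\<integral>\<^sup>+x. F x * indicator \<Omega> x \<partial>lebesgue)"
    using assms by (intro nn_integral_restrict_space) auto
  also have "\<dots> \<le> (\<integral>\<^sup>+x. F x * indicator K x \<partial>lebesgue)"
    using assms(4) by (intro nn_integral_mono) (auto split: split_indicator)
  also have "\<dots> = (\<integral>\<^sup>+x. F x * indicator K x \<partial>lborel)"
    by (intro nn_integral_completion) measurable
  finally show ?thesis .
qed

text \<open>The singularity at 0 is integrable because \<sigma> < 1; the negative half is the
  reflection of the positive one.\<close>

lemma nn_integral_abs_powr_finite: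
  fixes c \<sigma> :: real
  assumes "\<sigma> < 1" "c \<ge> 0"
  shows "(\<integral>\<^sup>+t. ennreal (\<bar>t\<bar> powr - \<sigma>) * indicator {-c..c} t \<partial>lborel) < \<infinity>"
proof -
  have "((\<lambda>x. x powr - \<sigma>) has_integral (c powr (- \<sigma> + 1) / (- \<sigma> + 1))) {0..c}"
    using assms by (intro has_integral_powr_from_0) auto
  then have I: "(\<integral>\<^sup>+t. ennreal (indicator {0..c} t * t powr - \<sigma>) \<partial>lborel) < \<infinity>" (is "?I < _")
    by (subst nn_integral_has_integral_lebesgue) auto
  have "(\<integral>\<^sup>+t. ennreal (indicator {0..c} t * t powr - \<sigma>) \<partial>lborel)
      = ennreal \<bar>-1\<bar> * (\<integral>\<^sup>+t. ennreal (indicator {0..c} (0 + (-1) * t) * (0 + (-1) * t) powr - \<sigma>) \<partial>lborel)"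
    by (rule nn_integral_real_affine) auto
  then have I': "(\<integral>\<^sup>+t. ennreal (indicator {0..c} (- t) * (- t) powr - \<sigma>) \<partial>lborel) = ?I"
    by simp
  have "(\<integral>\<^sup>+t. ennreal (\<bar>t\<bar> powr - \<sigma>) * indicator {-c..c} t \<partial>lborel)
     \<le> (\<integral>\<^sup>+t. ennreal (indicator {0..c} t * t powr - \<sigma>) + ennreal (indicator {0..c} (- t) * (- t) powr - \<sigma>) \<partial>lborel)"
    by (intro nn_integral_mono) (auto split: split_indicator simp: abs_if simp flip: ennreal_plus)
  also have "\<dots> = ?I + (\<integral>\<^sup>+t. ennreal (indicator {0..c} (- t) * (- t) powr - \<sigma>) \<partial>lborel)"
    by (intro nn_integral_add) auto
  also have "\<dots> < \<infinity>" using I I' by simp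
  finally show ?thesis .
qed

text \<open>
  Since \<open>\<bar>s\<bar> * \<bar>t\<bar> \<le> (norm (s, t))\<^sup>2\<close>, the singularity is dominated by a product of
  one-dimensional ones. The majorant \<open>G\<close> takes the value \<open>\<infinity>\<close> at \<open>0\<close>, where \<open>powr\<close> would give \<open>0\<close>.
\<close>

lemma nn_integral_norm_powr_finite:
  fixes c \<sigma> :: real
  assumes "0 \<le> \<sigma>" "\<sigma> < 1" "c \<ge> 0"
  shows "(\<integral>\<^sup>+z. ennreal (norm z powr - (2 * \<sigma>)) * indicator ({-c..c} \<times> {-c..c}) z
           \<partial>(lborel :: (real \<times> real) measure)) < \<infinity>"
proof -
  define G where "G t = (if t = 0 then \<infinity> else ennreal (\<bar>t\<bar> powr - \<sigma>)) * indicator {-c..c} t" for t :: real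
  have [measurable]: "G \<in> borel_measurable borel" unfolding G_def by measurable
  have "(\<integral>\<^sup>+t. G t \<partial>lborel) = (\<integral>\<^sup>+t. ennreal (\<bar>t\<bar> powr - \<sigma>) * indicator {-c..c} t \<partial>lborel)"
    by (rule nn_integral_cong_AE, use AE_lborel_singleton[of 0] in eventually_elim) (simp add: G_def)
  then have G: "(\<integral>\<^sup>+t. G t \<partial>lborel) < \<infinity>" using nn_integral_abs_powr_finite[OF assms(2,3)] by simp
  have le: "ennreal (norm z powr - (2 * \<sigma>)) * indicator ({-c..c} \<times> {-c..c}) z \<le> G (fst z) * G (snd z)"
    for z :: "real \<times> real"
  proof (cases "z \<in> {-c..c} \<times> {-c..c} \<and> z \<noteq> 0")
    case True
    then obtain s t where z: "z = (s, t)" "s \<in> {-c..c}" "t \<in> {-c..c}" "s \<noteq> 0 \<or> t \<noteq> 0"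
      by (cases z) (auto simp: zero_prod_def)
    show ?thesis
    proof (cases "s = 0 \<or> t = 0")
      case True
      then have "G s * G t = \<infinity>"
        using z by (auto simp: G_def ennreal_mult_eq_top_iff ennreal_top_mult ennreal_mult_top)
      then show ?thesis using z by simp
    next
      case False
      have "\<bar>s\<bar> * \<bar>t\<bar> \<le> (norm z)\<^sup>2"
      proof -
        have "2 * (\<bar>s\<bar> * \<bar>t\<bar>) \<le> s\<^sup>2 + t\<^sup>2"
          using sum_squares_bound[of "\<bar>s\<bar>" "\<bar>t\<bar>"] by (simp add: mult.assoc)
        moreover have "(norm z)\<^sup>2 = s\<^sup>2 + t\<^sup>2" using z(1) by (simp add: norm_prod_def)
        moreover have "0 \<le> \<bar>s\<bar> * \<bar>t\<bar>" by simp
        ultimately show ?thesis by linarith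
      qed
      then have "((norm z)\<^sup>2) powr - \<sigma> \<le> (\<bar>s\<bar> * \<bar>t\<bar>) powr - \<sigma>"
        using False assms by (intro powr_mono2') auto
      moreover have "((norm z)\<^sup>2) powr - \<sigma> = norm z powr - (2 * \<sigma>)"
        using True by (simp add: powr_powr flip: powr_numeral)
      ultimately have "norm z powr - (2 * \<sigma>) \<le> \<bar>s\<bar> powr - \<sigma> * \<bar>t\<bar> powr - \<sigma>"
        by (simp add: powr_mult)
      then show ?thesis using z False by (simp add: G_def flip: ennreal_mult) 
    qed
  qed (auto split: split_indicator)
  have "(\<integral>\<^sup>+z. ennreal (norm z powr - (2 * \<sigma>)) * indicator ({-c..c} \<times> {-c..c}) z \<partial>(lborel :: (real \<times> real) measure))
    \<le> (\<integral>\<^sup>+z. G (fst z) * G (snd z) \<partial>(lborel \<Otimes>\<^sub>M lborel))"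
    unfolding lborel_prod by (rule nn_integral_mono) (rule le)
  also have "\<dots> = (\<integral>\<^sup>+s. \<integral>\<^sup>+t. G s * G t \<partial>lborel \<partial>lborel)"
    by (subst lborel.nn_integral_fst[symmetric]) auto
  also have "\<dots> = (\<integral>\<^sup>+t. G t \<partial>lborel) * (\<integral>\<^sup>+t. G t \<partial>lborel)"
    by (simp add: nn_integral_cmult nn_integral_multc)
  also have "\<dots> < \<infinity>" using G by (simp add: ennreal_mult_less_top)
  finally show ?thesis .
qed

text \<open>The partial derivatives are bounded on the compact ball, and its convexity allows the
  mean value inequality. A sector with large angle would not be convex.\<close>

lemma smooth_Lipschitz_on_cball:
  fixes f :: "'a::euclidean_space \<Rightarrow> real"
  assumes "smooth f"
  shows "\<exists>L\<ge>0. \<forall>x\<in>cball 0 R. \<forall>y\<in>cball 0 R. \<bar>f x - f y\<bar> \<le> L * dist x y"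
proof -
  have "\<exists>B\<ge>0. \<forall>x\<in>cball 0 R. \<bar>partial_deriv b f x\<bar> \<le> B" if "b \<in> Basis" for b
  proof -
    have "smooth (partial_deriv b f)"
      using smooth_partial_derivs[OF assms, of "[b]"] that by (simp add: partial_derivs_Cons)
    then have "bounded (partial_deriv b f ` cball 0 R)"
      by (intro compact_imp_bounded compact_continuous_image smooth_continuous_on) auto
    then show ?thesis by (auto simp: bounded_pos intro: less_imp_le)
  qed
  then obtain B where B: "\<And>b. b \<in> Basis \<Longrightarrow> B b \<ge> 0"
    "\<And>b x. b \<in> Basis \<Longrightarrow> x \<in> cball 0 R \<Longrightarrow> \<bar>partial_deriv b f x\<bar> \<le> B b"
    by metis
  have diff: "f differentiable (at x)" for x
    using smooth_differentiable[OF assms, of "[]"] by simp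
  define L where "L = sum B Basis"
  have "norm (f x - f y) \<le> L * norm (x - y)" if "x \<in> cball 0 R" "y \<in> cball 0 R" for x y
  proof (rule differentiable_bound[OF convex_cball[of 0 R] _ _ that])
    fix z :: 'a assume z: "z \<in> cball 0 R"
    let ?D = "frechet_derivative f (at z)"
    show "(f has_derivative ?D) (at z within cball 0 R)"
      using diff by (simp add: frechet_derivative_works has_derivative_at_withinI)
    have lin: "linear ?D" using diff by (rule linear_frechet_derivative)
    show "onorm ?D \<le> L"
    proof (rule onorm_le)
      fix v
      have "?D v = ?D (\<Sum>b\<in>Basis. (v \<bullet> b) *\<^sub>R b)" by (simp add: euclidean_representation)
      also have "\<dots> = (\<Sum>b\<in>Basis. (v \<bullet> b) * partial_deriv b f z)"
        by (simp add: linear_sum[OF lin] linear_cmul[OF lin] partial_deriv_def)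
      finally have "norm (?D v) \<le> (\<Sum>b\<in>Basis. \<bar>v \<bullet> b\<bar> * \<bar>partial_deriv b f z\<bar>)"
        using sum_abs[of "\<lambda>b. (v \<bullet> b) * partial_deriv b f z" Basis] by (simp add: abs_mult)
      also have "\<dots> \<le> (\<Sum>b\<in>Basis. norm v * B b)"
        by (intro sum_mono mult_mono B z Basis_le_norm) auto
      finally show "norm (?D v) \<le> L * norm v"
        by (simp add: L_def sum_distrib_left mult.commute)
    qed
  qed
  moreover have "L \<ge> 0" unfolding L_def using B by (intro sum_nonneg)
  ultimately show ?thesis by (auto simp: dist_norm)
qed

text \<open>The Lipschitz bound reduces the integrand to \<open>L\<^sup>2\<close> times the distance
  to the power -2\<sigma>. In the plane this is integrable in y, uniformly in x, because 2\<sigma> <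
  2.\<close>

lemma smooth_slobodeckij_energy_finite:
  fixes f :: "real \<times> real \<Rightarrow> real"
  assumes "smooth f" and "bounded \<Omega>" and [measurable]: "\<Omega> \<in> sets borel" and "0 \<le> \<sigma>" "\<sigma> < 1"
  shows "slobodeckij_energy \<sigma> \<Omega> f < \<infinity>"
proof -
  obtain R where R: "R > 0" "\<Omega> \<subseteq> cball 0 R"
    using assms(2) unfolding bounded_pos subset_iff mem_cball_0 by blast
  obtain L where L: "L \<ge> 0" "\<And>x y. x \<in> cball 0 R \<Longrightarrow> y \<in> cball 0 R \<Longrightarrow> \<bar>f x - f y\<bar> \<le> L * dist x y"
    using smooth_Lipschitz_on_cball[OF assms(1)] by blast
  \<comment> \<open>The square contains all differences of two points of
    \<open>cball 0 R\<close>.\<close>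
  let ?Q = "{-(2*R)..2*R} \<times> {-(2*R)..2*R} :: (real \<times> real) set"
  have [measurable]: "?Q \<in> sets borel" by (intro borel_closed closed_Times) auto
  define J where "J = (\<integral>\<^sup>+z. ennreal (norm z powr - (2 * \<sigma>)) * indicator ?Q z
           \<partial>(lborel :: (real \<times> real) measure))"
  have J: "J < \<infinity>"
    unfolding J_def using assms R by (intro nn_integral_norm_powr_finite) auto
  have inner: "(\<integral>\<^sup>+y. ennreal ((f x - f y)\<^sup>2 / dist x y powr (real DIM(real \<times> real) + 2 * \<sigma>)) \<partial>lebesgue_on \<Omega>)
      \<le> ennreal (L\<^sup>2) * J" if x: "x \<in> \<Omega>" for x
  proof -
    \<comment> \<open>The square recentred at x; translation invariance later moves the integral
      back to \<open>?Q\<close>.\<close>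
    define K where "K = (\<lambda>y. y - x) -` ?Q"
    have [measurable]: "K \<in> sets borel"
      unfolding K_def using measurable_sets[of "\<lambda>y. y - x" borel borel ?Q] by simp
    have "\<Omega> \<subseteq> K"
    proof
      fix y assume "y \<in> \<Omega>"
      then have "norm y \<le> R" "norm x \<le> R" using x R(2) unfolding subset_iff mem_cball_0 by blast+
      then have "norm (y - x) \<le> 2 * R" using norm_triangle_ineq4[of y x] by linarith
      then have "\<bar>fst (y - x)\<bar> \<le> 2 * R" "\<bar>snd (y - x)\<bar> \<le> 2 * R"
        using norm_fst_le[of "fst (y - x)" "snd (y - x)"] norm_snd_le[of "snd (y - x)" "fst (y - x)"]
        unfolding prod.collapse real_norm_def by linarith+
      then show "y \<in> K" by (auto simp: K_def mem_Times_iff)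
    qed
    have "(\<integral>\<^sup>+y. ennreal ((f x - f y)\<^sup>2 / dist x y powr (real DIM(real \<times> real) + 2 * \<sigma>)) \<partial>lebesgue_on \<Omega>)
       \<le> (\<integral>\<^sup>+y. ennreal (L\<^sup>2 * norm (y - x) powr - (2 * \<sigma>)) \<partial>lebesgue_on \<Omega>)"
    proof (rule nn_integral_mono, rule ennreal_leI)
      fix y assume "y \<in> space (lebesgue_on \<Omega>)"
      then have y: "y \<in> cball 0 R" and x: "x \<in> cball 0 R" using R x by auto
      show "(f x - f y)\<^sup>2 / dist x y powr (real DIM(real \<times> real) + 2 * \<sigma>) \<le> L\<^sup>2 * norm (y - x) powr - (2 * \<sigma>)"
      proof (cases "x = y")
        case False
        then have d: "dist x y > 0" by simp
        have "(f x - f y)\<^sup>2 \<le> (L * dist x y)\<^sup>2"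
          using L(2)[OF x y] by (intro abs_le_square_iff[THEN iffD1]) (use L(1) in auto)
        also have "\<dots> = L\<^sup>2 * (dist x y powr 2)" using d by (simp add: power_mult_distrib)
        finally have "(f x - f y)\<^sup>2 / dist x y powr (2 + 2 * \<sigma>) \<le> L\<^sup>2 * (dist x y powr 2) / dist x y powr (2 + 2 * \<sigma>)"
          by (intro divide_right_mono) auto
        also have "\<dots> = L\<^sup>2 * norm (y - x) powr - (2 * \<sigma>)"
          using d by (simp add: powr_add powr_minus dist_norm norm_minus_commute divide_simps)
        finally show ?thesis by simp
      qed simp
    qed
    also have "\<dots> \<le> (\<integral>\<^sup>+y. ennreal (L\<^sup>2 * norm (y - x) powr - (2 * \<sigma>)) * indicator K y \<partial>lborel)"
      by (rule nn_integral_lebesgue_on_le) (use \<open>\<Omega> \<subseteq> K\<close> in auto)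
    also have "\<dots> = (\<integral>\<^sup>+y. ennreal (L\<^sup>2 * norm (y - x) powr - (2 * \<sigma>)) * indicator K y \<partial>distr lborel borel ((+) x))"
      by (simp add: lborel_distr_plus)
    also have "\<dots> = (\<integral>\<^sup>+z. ennreal (L\<^sup>2 * norm z powr - (2 * \<sigma>)) * indicator ?Q z \<partial>lborel)"
      by (subst nn_integral_distr) (auto simp: K_def indicator_def)
    also have "\<dots> = ennreal (L\<^sup>2) * J"
      unfolding J_def by (subst nn_integral_cmult[symmetric]) (auto simp: ennreal_mult mult.assoc)
    finally show ?thesis .
  qed
  have "slobodeckij_energy \<sigma> \<Omega> f \<le> (\<integral>\<^sup>+x. ennreal (L\<^sup>2) * J \<partial>lebesgue_on \<Omega>)"
    unfolding slobodeckij_energy_def by (rule nn_integral_mono) (use inner in auto)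
  also have "\<dots> = ennreal (L\<^sup>2) * J * emeasure (lebesgue_on \<Omega>) \<Omega>"
    by simp
  also have "\<dots> < \<infinity>"
    using J emeasure_bounded_finite[OF assms(2)]
    by (simp add: emeasure_restrict_space ennreal_mult_less_top)
  finally show ?thesis .
qed

section \<open>Smooth functions lie in all Sobolev-Slobodeckij spaces of a bounded open set\<close>

lemma continuous_L2_on:
  fixes f :: "'a::euclidean_space \<Rightarrow> real"
  assumes "continuous_on UNIV f" "bounded \<Omega>" "\<Omega> \<in> sets borel"
  shows "f \<in> L2_on \<Omega>"
proof -
  have meas: "f \<in> borel_measurable (lebesgue_on \<Omega>)"
    using assms by (intro continuous_imp_measurable_on_sets_lebesgue continuous_on_subset[OF assms(1)]) auto
  obtain R where R: "\<Omega> \<subseteq> cball 0 R"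
    using assms(2) unfolding bounded_pos subset_iff mem_cball_0 by blast
  have "bounded (f ` cball 0 R)"
    by (intro compact_imp_bounded compact_continuous_image continuous_on_subset[OF assms(1)]) auto
  then obtain B where B: "\<And>x. x \<in> cball 0 R \<Longrightarrow> \<bar>f x\<bar> \<le> B" "B > 0"
    unfolding bounded_pos real_norm_def by blast
  interpret finite_measure "lebesgue_on \<Omega>"
    using assms by (intro finite_measure_lebesgue_on bounded_set_imp_lmeasurable) auto
  have "integrable (lebesgue_on \<Omega>) (\<lambda>x. (f x)\<^sup>2)"
    using meas R B by (intro integrable_const_bound[of _ "B\<^sup>2"])
       (auto simp: subset_iff power2_le_iff_abs_le intro!: AE_I2)
  with meas show ?thesis by (simp add: L2_on_def)
qed

text \<open>All ingredients of the space see only the values on \<open>\<Omega>\<close>, so the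
  classical derivatives of the globally smooth \<open>f\<close> serve as weak derivatives of
  \<open>u\<close>, with no regularity of the boundary involved.\<close>

lemma smooth_in_sobolev_slobodeckij:
  fixes f u :: "real \<times> real \<Rightarrow> real"
  assumes f: "smooth f" and \<Omega>: "open \<Omega>" "bounded \<Omega>" and eq: "\<And>x. x \<in> \<Omega> \<Longrightarrow> u x = f x"
    and s: "s \<ge> 0"
  shows "u \<in> sobolev_slobodeckij s \<Omega>"
proof -
  have b: "\<Omega> \<in> sets borel" using \<Omega> by simp
  have fL2: "partial_derivs bs f \<in> L2_on \<Omega>" if "bs \<in> lists Basis" for bs
    by (rule continuous_L2_on[OF smooth_continuous_on[OF smooth_partial_derivs[OF f that]] \<Omega>(2) b])
  have "u \<in> borel_measurable (lebesgue_on \<Omega>) \<longleftrightarrow> f \<in> borel_measurable (lebesgue_on \<Omega>)"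
    by (rule measurable_cong) (simp add: eq)
  moreover have "integrable (lebesgue_on \<Omega>) (\<lambda>x. (u x)\<^sup>2) \<longleftrightarrow> integrable (lebesgue_on \<Omega>) (\<lambda>x. (f x)\<^sup>2)"
    by (rule Bochner_Integration.integrable_cong) (simp_all add: eq)
  ultimately have uL2: "u \<in> L2_on \<Omega>"
    using fL2[of "[]"] by (simp add: L2_on_def)
  have weak: "is_weak_deriv \<Omega> bs u (partial_derivs (rev bs) f)" if "bs \<in> lists Basis" for bs
  proof -
    have "(LINT x|lebesgue_on \<Omega>. u x * partial_derivs bs \<phi> x) = (LINT x|lebesgue_on \<Omega>. f x * partial_derivs bs \<phi> x)" for \<phi>
      by (rule Bochner_Integration.integral_cong) (simp_all add: eq)
    with smooth_imp_weak_deriv[OF f \<Omega>(1) that] show ?thesis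
      by (simp add: is_weak_deriv_def)
  qed
  have rev: "rev bs \<in> lists Basis" if "bs \<in> lists Basis" for bs :: "(real \<times> real) list"
    using that by auto
  \<comment> \<open>The fractional part lies in [0, 1). The energy bound includes the order 0, so
    integral and non-integral \<open>s\<close> are handled together.\<close>
  have "slobodeckij_energy (s - of_int \<lfloor>s\<rfloor>) \<Omega> (partial_derivs (rev bs) f) < \<infinity>"
    if "bs \<in> lists Basis" for bs
    by (rule smooth_slobodeckij_energy_finite[OF smooth_partial_derivs[OF f rev[OF that]] \<Omega>(2) b])
       linarith+
  then show ?thesis
    using uL2 weak fL2 rev unfolding sobolev_slobodeckij_def sobolev_def by blast
qed

subsection \<open>The eigenfunction near the vertex\<close>

lemma Gamma_add_nat_ge:
  assumes "\<nu> \<ge> (0::real)"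
  shows "Gamma (\<nu> + 1) \<le> Gamma (\<nu> + real j + 1)"
proof (induction j)
  case (Suc j)
  have "Gamma (\<nu> + real (Suc j) + 1) = (\<nu> + real j + 1) * Gamma (\<nu> + real j + 1)"
    using Gamma_plus1[of "\<nu> + real j + 1"] nonpos_Ints_nonpos[of "\<nu> + real j + 1"] assms
    by (fastforce simp: add_ac)
  moreover have "1 * Gamma (\<nu> + real j + 1) \<le> (\<nu> + real j + 1) * Gamma (\<nu> + real j + 1)"
    using assms by (intro mult_right_mono Gamma_real_nonneg) auto
  ultimately show ?case using Suc by simp
qed simp

text \<open>Comparison with the exponential series: \<open>Gamma (\<nu> + real j + 1)\<close> is
  bounded below by its value at \<open>j = 0\<close>.\<close>

lemma bessel_coeffs_summable:
  fixes t \<nu> :: real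
  assumes "\<nu> \<ge> 0"
  shows "summable (\<lambda>j. (-1) ^ j / (fact j * Gamma (\<nu> + real j + 1)) * t ^ j)"
proof (rule summable_comparison_test')
  show "summable (\<lambda>j. inverse (fact j) * \<bar>t\<bar> ^ j * inverse (Gamma (\<nu> + 1)))"
    by (intro summable_mult2 summable_exp)
  fix j
  have "0 < Gamma (\<nu> + 1)" using assms by (intro Gamma_real_pos) simp
  then have "inverse (Gamma (\<nu> + real j + 1)) \<le> inverse (Gamma (\<nu> + 1))"
    using Gamma_add_nat_ge[OF assms, of j] by (intro le_imp_inverse_le)
  then have "inverse (fact j) * \<bar>t\<bar> ^ j * inverse (Gamma (\<nu> + real j + 1))
     \<le> inverse (fact j) * \<bar>t\<bar> ^ j * inverse (Gamma (\<nu> + 1))"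
    by (intro mult_left_mono) auto
  moreover have "\<bar>Gamma (\<nu> + real j + 1)\<bar> = Gamma (\<nu> + real j + 1)"
    using Gamma_real_pos[of "\<nu> + real j + 1"] assms by simp
  ultimately show "norm ((-1) ^ j / (fact j * Gamma (\<nu> + real j + 1)) * t ^ j)
      \<le> inverse (fact j) * \<bar>t\<bar> ^ j * inverse (Gamma (\<nu> + 1))"
    by (simp add: abs_mult power_abs divide_inverse mult_ac)
qed

text \<open>The scaling by \<mu> is absorbed into the coefficients \<open>c\<close>. Since
  \<open>c 0\<close> is nonzero, the factor \<open>r powr \<nu>\<close> is the exact leading
  behaviour at the vertex.\<close>

lemma bessel_J_scaled_power_series:
  fixes \<nu> \<mu> :: real
  assumes "\<nu> \<ge> 0" "\<mu> > 0"
  obtains c :: "nat \<Rightarrow> real" where "\<And>t. summable (\<lambda>n. c n * t ^ n)" "c 0 \<noteq> 0"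
    "\<And>r. r > 0 \<Longrightarrow> bessel_J \<nu> (\<mu> * r) = r powr \<nu> * (\<Sum>n. c n * (r\<^sup>2) ^ n)"
proof
  let ?b = "\<lambda>j. (-1) ^ j / (fact j * Gamma (\<nu> + real j + 1))"
  define c where "c = (\<lambda>n. (\<mu> / 2) powr \<nu> * (?b n * ((\<mu> / 2)\<^sup>2) ^ n))"
  have c_mult: "c n * t ^ n = (\<mu> / 2) powr \<nu> * (?b n * ((\<mu> / 2)\<^sup>2 * t) ^ n)" for n t
    unfolding c_def by (simp add: power_mult_distrib mult_ac)
  show "summable (\<lambda>n. c n * t ^ n)" for t
    unfolding c_mult by (intro summable_mult bessel_coeffs_summable assms)
  have "Gamma (\<nu> + 1) > 0" using assms by (intro Gamma_real_pos) simp
  then have "Gamma (\<nu> + 1) \<noteq> 0" by linarith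
  then show "c 0 \<noteq> 0" using assms by (simp add: c_def)
  show "bessel_J \<nu> (\<mu> * r) = r powr \<nu> * (\<Sum>n. c n * (r\<^sup>2) ^ n)" if "r > 0" for r
  proof -
    have "?b j * (if 2 * real j + \<nu> = 0 then 1 else (\<mu> * r / 2) powr (2 * real j + \<nu>))
        = (\<mu> / 2 * r) powr \<nu> * (?b j * ((\<mu> / 2)\<^sup>2 * r\<^sup>2) ^ j)" for j
    proof -
      have pos: "\<mu> / 2 * r > 0" using assms that by simp
      have "(\<mu> / 2 * r) powr (2 * real j) = ((\<mu> / 2)\<^sup>2 * r\<^sup>2) ^ j"
        using powr_realpow[OF pos, of "2 * j"] by (simp add: power_mult power_divide flip: power_mult_distrib)
      \<comment> \<open>For a positive base the special value at exponent 0 agrees with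
        \<open>powr\<close>.\<close>
      moreover have "(if 2 * real j + \<nu> = 0 then 1 else (\<mu> * r / 2) powr (2 * real j + \<nu>))
          = (\<mu> / 2 * r) powr (2 * real j + \<nu>)"
        using pos by auto
      ultimately show ?thesis by (simp add: powr_add mult_ac)
    qed
    then have "bessel_J \<nu> (\<mu> * r) = (\<Sum>j. (\<mu> / 2 * r) powr \<nu> * (?b j * ((\<mu> / 2)\<^sup>2 * r\<^sup>2) ^ j))"
      unfolding bessel_J_def by (simp only:)
    also have "\<dots> = (\<mu> / 2 * r) powr \<nu> * (\<Sum>j. ?b j * ((\<mu> / 2)\<^sup>2 * r\<^sup>2) ^ j)"
      by (intro suminf_mult bessel_coeffs_summable assms)
    also have "\<dots> = r powr \<nu> * ((\<mu> / 2) powr \<nu> * (\<Sum>j. ?b j * ((\<mu> / 2)\<^sup>2 * r\<^sup>2) ^ j))"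
      using powr_mult[of "\<mu> / 2" r \<nu>] assms that by (simp only: mult_ac less_imp_le zero_le_divide_iff)
    also have "(\<mu> / 2) powr \<nu> * (\<Sum>j. ?b j * ((\<mu> / 2)\<^sup>2 * r\<^sup>2) ^ j) = (\<Sum>n. c n * (r\<^sup>2) ^ n)"
      unfolding c_mult by (intro suminf_mult[symmetric] bessel_coeffs_summable assms)
    finally show ?thesis .
  qed
qed

section \<open>Geometry of the sector\<close>

lemma norm_polar: "r \<ge> 0 \<Longrightarrow> norm (r * cos \<phi>, r * sin \<phi>) = r"
  by (simp add: norm_prod_def power_mult_distrib flip: distrib_left)

text \<open>Two angles in (0, \<omega>) differ by less than 2 pi, so polar coordinates are injective
  on the open rectangle, and invariance of domain makes the image open.\<close>

lemma open_sector:
  assumes "\<omega> \<le> 2 * pi"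
  shows "open (sector \<omega>)"
proof -
  let ?f = "\<lambda>(r, \<phi>). (r * cos \<phi>, r * sin \<phi>) :: real \<times> real"
  let ?S = "{0<..<1::real} \<times> {0<..<\<omega>}"
  have eq: "sector \<omega> = ?f ` ?S" by (auto simp: sector_def image_def) (force, blast)
  have "inj_on ?f ?S"
  proof (rule inj_onI, clarify, goal_cases)
    case (1 r a s b)
    then have "r = s" using norm_polar[of r a] norm_polar[of s b] by simp
    with 1 have "sin b = sin a \<and> cos b = cos a" by auto
    then obtain n :: int where n: "b = a + 2 * pi * n"
      unfolding sin_cos_eq_iff by auto
    have "\<bar>2 * pi * n\<bar> < 2 * pi * 1" using n 1 assms by auto
    then have "\<bar>real_of_int n\<bar> < 1" by (simp add: abs_mult)
    then have "n = 0" by linarith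
    with n \<open>r = s\<close> show ?case by simp
  qed
  moreover have "continuous_on ?S ?f"
    by (auto intro!: continuous_intros simp: case_prod_unfold)
  moreover have "open ?S" by (intro open_Times) auto
  ultimately show ?thesis unfolding eq by (intro invariance_of_domain_gen order_refl)
qed

lemma sector_subset_ball: "sector \<omega> \<subseteq> ball 0 1"
  by (auto simp: sector_def norm_polar)

lemma bounded_sector: "bounded (sector \<omega>)"
  using bounded_subset[OF bounded_ball sector_subset_ball] .

text \<open>Contraction towards the vertex keeps the supports of the rescaled bumps inside the
  sector.\<close>

lemma scaleR_sector:
  assumes "0 < t" "t \<le> 1" "x \<in> sector \<omega>"
  shows "t *\<^sub>R x \<in> sector \<omega>"
proof -
  obtain r \<phi> where "x = (r * cos \<phi>, r * sin \<phi>)" "0 < r" "r < 1" "0 < \<phi>" "\<phi> < \<omega>"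
    using assms(3) by (auto simp: sector_def)
  moreover from this have "0 < t * r" "t * r < 1"
    using assms(1,2) mult_right_mono[of t 1 r] by (simp, linarith)
  ultimately show ?thesis
    unfolding sector_def mem_Collect_eq
    by (intro exI[of _ "t * r"] exI[of _ \<phi>]) (simp add: mult.assoc)
qed

section \<open>Integral order: the smooth extension of the eigenfunction\<close>

lemma Re_Im_power_smooth_alg:
  "(\<lambda>p :: real \<times> real. Re (Complex (fst p) (snd p) ^ n)) \<in> smooth_alg \<and>
   (\<lambda>p :: real \<times> real. Im (Complex (fst p) (snd p) ^ n)) \<in> smooth_alg"
proof (induction n)
  case 0
  show ?case by (simp add: smooth_alg.const)
next
  \<comment> \<open>The real part of the next power involves both parts of the previous one, which
    is why both are treated in one induction.\<close>
  case (Suc n)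
  have "(fst :: real \<times> real \<Rightarrow> real) \<in> smooth_alg" "(snd :: real \<times> real \<Rightarrow> real) \<in> smooth_alg"
    using smooth_alg.inner[of "(1, 0) :: real \<times> real"] smooth_alg.inner[of "(0, 1) :: real \<times> real"]
    by (simp_all add: inner_prod_def)
  with Suc show ?case
    by (auto intro!: smooth_alg.add smooth_alg_diff smooth_alg.mult)
qed

lemma sobolev_slobodeckij_bessel_nat:
  fixes u :: "real \<times> real \<Rightarrow> real" and n :: nat
  assumes "\<omega> \<le> 2 * pi" "\<mu> > 0" "s \<ge> 0"
    and u: "\<And>r \<phi>. \<lbrakk>0 < r; r < 1; 0 < \<phi>; \<phi> < \<omega>\<rbrakk> \<Longrightarrow>
           u (r * cos \<phi>, r * sin \<phi>) = bessel_J (real n) (\<mu> * r) * cos (real n * \<phi>)"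
  shows "u \<in> sobolev_slobodeckij s (sector \<omega>)"
proof -
  obtain c where c: "\<And>t. summable (\<lambda>n. c n * t ^ n)"
    "\<And>r. r > 0 \<Longrightarrow> bessel_J (real n) (\<mu> * r) = r powr real n * (\<Sum>n. c n * (r\<^sup>2) ^ n)"
    using bessel_J_scaled_power_series[of "real n" \<mu>] assms(2) by (metis of_nat_0_le_iff)
  \<comment> \<open>The eigenfunction in Cartesian coordinates: \<open>r\<^sup>2\<close> becomes a
    polynomial, and r^n cos(n \<phi>) becomes Re (z^n) by de Moivre. The formula makes sense on the
    whole plane.\<close>
  define U where "U p = (\<Sum>n. c n * ((fst p)\<^sup>2 + (snd p)\<^sup>2) ^ n) * Re (Complex (fst p) (snd p) ^ n)" for p
  have "(\<lambda>p. (fst p)\<^sup>2 + (snd p)\<^sup>2) \<in> smooth_alg"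
    using Re_Im_power_smooth_alg[of 1] by (auto simp: power2_eq_square intro!: smooth_alg.add smooth_alg.mult)
  then have "U \<in> smooth_alg"
    unfolding U_def using Re_Im_power_smooth_alg[of n] c(1)
    by (intro smooth_alg.mult smooth_alg.power_series) auto
  moreover have "u p = U p" if p: "p \<in> sector \<omega>" for p
  proof -
    obtain r \<phi> where r: "p = (r * cos \<phi>, r * sin \<phi>)" "0 < r" "r < 1" "0 < \<phi>" "\<phi> < \<omega>"
      using p by (auto simp: sector_def)
    have "Complex (r * cos \<phi>) (r * sin \<phi>) = of_real r * cis \<phi>"
      by (simp add: complex_eq_iff)
    then have "Re (Complex (r * cos \<phi>) (r * sin \<phi>) ^ n) = r ^ n * cos (real n * \<phi>)"
      by (simp add: power_mult_distrib Complex.DeMoivre flip: of_real_power)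
    moreover have "(r * cos \<phi>)\<^sup>2 + (r * sin \<phi>)\<^sup>2 = r\<^sup>2"
      by (simp add: power_mult_distrib flip: distrib_left)
    ultimately show ?thesis
      using u[OF r(2-5)] r c(2)[OF r(2)] by (simp add: U_def powr_realpow)
  qed
  ultimately show ?thesis
    using smooth_in_sobolev_slobodeckij[OF smooth_alg_smooth open_sector bounded_sector] assms by blast
qed

subsection \<open>Blow-up at the vertex\<close>

text \<open>Re (z^\<beta>) for the principal branch. It is differentiated only in the right
  half-plane, where the branch is holomorphic.\<close>

definition re_powr :: "real \<Rightarrow> real \<times> real \<Rightarrow> real" where
  "re_powr \<beta> p = Re (Complex (fst p) (snd p) powr of_real \<beta>)"

text \<open>The range of \<phi> is that of the imaginary part of the principal logarithm, so
  \<open>Ln\<close> recovers \<open>Complex (ln r) \<phi>\<close>.\<close>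

lemma re_powr_polar:
  assumes "r > 0" "- pi < \<phi>" "\<phi> \<le> pi"
  shows "re_powr \<beta> (r * cos \<phi>, r * sin \<phi>) = r powr \<beta> * cos (\<beta> * \<phi>)"
proof -
  have "Complex (r * cos \<phi>) (r * sin \<phi>) = exp (Complex (ln r) \<phi>)"
    using assms by (simp add: complex_eq_iff Re_exp Im_exp)
  moreover have "Ln (exp (Complex (ln r) \<phi>)) = Complex (ln r) \<phi>"
    using assms by (intro Ln_exp) auto
  ultimately have "re_powr \<beta> (r * cos \<phi>, r * sin \<phi>) = Re (exp (of_real \<beta> * Complex (ln r) \<phi>))"
    by (simp add: re_powr_def powr_def)
  then show ?thesis using assms by (simp add: Re_exp powr_def mult.commute)
qed

lemma re_powr_has_derivative:
  assumes "fst p > 0"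
  shows "(re_powr \<beta> has_derivative
    (\<lambda>h. Re (of_real \<beta> * Complex (fst p) (snd p) powr (of_real \<beta> - 1) * Complex (fst h) (snd h)))) (at p)"
proof -
  have "((\<lambda>z. z powr of_real \<beta>) has_field_derivative
      of_real \<beta> * Complex (fst p) (snd p) powr (of_real \<beta> - 1)) (at (Complex (fst p) (snd p)))"
    using assms by (intro has_field_derivative_powr) (auto simp: complex_nonpos_Reals_iff)
  then have d: "((\<lambda>z. z powr of_real \<beta>) has_derivative
      (*) (of_real \<beta> * Complex (fst p) (snd p) powr (of_real \<beta> - 1))) (at (Complex (fst p) (snd p)))"
    by (rule has_field_derivative_imp_has_derivative)
  have "linear (\<lambda>p :: real \<times> real. Complex (fst p) (snd p))"
    by (intro linearI) (auto simp: complex_eq_iff)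
  then have "((\<lambda>p. Complex (fst p) (snd p)) has_derivative (\<lambda>h. Complex (fst h) (snd h))) (at p)"
    by (intro bounded_linear_imp_has_derivative linear_conv_bounded_linear[THEN iffD1])
  from has_derivative_compose[OF this d]
  show ?thesis
    unfolding re_powr_def by (rule has_derivative_Re)
qed

text \<open>The direction \<open>(1, 0)\<close> corresponds to the complex number 1, so the
  x-derivative is the real part of the complex derivative. This keeps repeated x-derivatives within
  the family of real powers.\<close>

lemma partial_deriv_re_powr:
  assumes "fst p > 0"
  shows "partial_deriv (1, 0) (re_powr \<beta>) p = \<beta> * re_powr (\<beta> - 1) p"
proof -
  have "Complex 1 0 = 1" by (simp add: complex_eq_iff)
  then have "partial_deriv (1, 0) (re_powr \<beta>) p
      = Re (of_real \<beta> * Complex (fst p) (snd p) powr (of_real \<beta> - 1))"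
    using partial_deriv_eq[OF re_powr_has_derivative[OF assms, of \<beta>], of "(1, 0)"] by simp
  moreover have "Re (of_real \<beta> * z) = \<beta> * Re z" for z
    by simp
  ultimately show ?thesis
    unfolding re_powr_def of_real_diff of_real_1 by simp
qed

lemma continuous_on_re_powr: "continuous_on {p. fst p > 0} (re_powr \<beta>)"
  by (intro continuous_at_imp_continuous_on ballI has_derivative_continuous)
     (auto intro: re_powr_has_derivative)

lemma open_right_half_plane: "open {p :: real \<times> real. fst p > 0}"
  by (intro open_Collect_less continuous_intros)

text \<open>
  Each integration by parts lowers the exponent by one and produces a factor \<open>\<beta> - i\<close>, which is
  nonzero because \<open>\<beta>\<close> is not a natural number.
\<close>

lemma integral_re_powr_partial_derivs_nonzero:
  fixes g :: "real \<times> real \<Rightarrow> real"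
  assumes g: "smooth g" and S: "compact S" "S \<subseteq> {p. fst p > 0}" "\<And>x. x \<notin> S \<Longrightarrow> g x = 0"
    and "\<beta> \<notin> \<nat>" and "integral\<^sup>L lborel (\<lambda>x. re_powr (\<beta> - real n) x * g x) \<noteq> 0"
  shows "integral\<^sup>L lborel (\<lambda>x. re_powr \<beta> x * partial_derivs (replicate n (1, 0)) g x) \<noteq> 0"
  using assms(5,6)
proof (induction n arbitrary: \<beta>)
  case (Suc n)
  define h where "h = partial_derivs (replicate n (1, 0)) g"
  have B: "replicate m (1 :: real, 0 :: real) \<in> lists Basis" for m
    by (auto simp: Basis_prod_def)
  have h: "smooth h" unfolding h_def by (rule smooth_partial_derivs[OF g B])
  have h': "smooth (partial_deriv (1, 0) h)"
    using smooth_partial_derivs[OF h B[of 1]] by (simp add: partial_derivs_Cons)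
  have "closure {x. g x \<noteq> 0} \<subseteq> S"
    using S by (intro closure_minimal) (auto intro: compact_imp_closed)
  then have h0: "h x = 0" if "x \<notin> S" for x
    using that closure_support_partial_derivs[of "replicate n (1, 0)" g]
      closure_subset[of "{x. h x \<noteq> 0}"] unfolding h_def by blast
  have cont: "continuous_on {p. fst p > 0} (partial_deriv (1, 0) (re_powr \<beta>))"
    using continuous_on_cong[of "{p. fst p > 0}" "{p. fst p > 0}" "partial_deriv (1, 0) (re_powr \<beta>)"
      "\<lambda>p. \<beta> * re_powr (\<beta> - 1) p"] partial_deriv_re_powr
    by (auto intro!: continuous_intros continuous_on_re_powr)
  have "integral\<^sup>L lborel (\<lambda>x. re_powr \<beta> x * partial_deriv (1, 0) h x)
      = - integral\<^sup>L lborel (\<lambda>x. partial_deriv (1, 0) (re_powr \<beta>) x * h x)"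
  proof (rule integration_by_parts[OF open_right_half_plane _ cont _ smooth_continuous_on[OF h'] S(1,2) h0])
    show "re_powr \<beta> differentiable at x" if "x \<in> {p. fst p > 0}" for x
      using re_powr_has_derivative[of x] that unfolding differentiable_def by blast
    show "h differentiable at x" for x
      using smooth_differentiable[OF h, of "[]"] by simp
  qed
  \<comment> \<open>The derivative formula holds in the half-plane only; points outside it lie off
    \<open>S\<close>, where \<open>h\<close> vanishes.\<close>
  also have "(\<lambda>x. partial_deriv (1, 0) (re_powr \<beta>) x * h x) = (\<lambda>x. \<beta> * (re_powr (\<beta> - 1) x * h x))"
  proof
    show "partial_deriv (1, 0) (re_powr \<beta>) x * h x = \<beta> * (re_powr (\<beta> - 1) x * h x)" for x
      using partial_deriv_re_powr[of x \<beta>] h0[of x] S(2) by (cases "x \<in> S") auto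
  qed
  finally have eq: "integral\<^sup>L lborel (\<lambda>x. re_powr \<beta> x * partial_deriv (1, 0) h x)
      = - (\<beta> * integral\<^sup>L lborel (\<lambda>x. re_powr (\<beta> - 1) x * h x))" by simp
  have "\<beta> - 1 \<notin> \<nat>"
    using Suc.prems(1) Nats_1 Nats_add[of "\<beta> - 1" 1] by auto
  then have "integral\<^sup>L lborel (\<lambda>x. re_powr (\<beta> - 1) x * h x) \<noteq> 0"
    unfolding h_def using Suc.prems(2) by (intro Suc.IH) (simp_all add: algebra_simps)
  moreover have "\<beta> \<noteq> 0" using Suc.prems(1) Nats_0 by metis
  ultimately show ?case using eq by (simp add: partial_derivs_Cons h_def)
qed simp

section \<open>Rescaling and bump functions\<close>

lemma partial_derivs_scaleR:
  fixes f :: "'a::euclidean_space \<Rightarrow> real"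
  assumes "smooth f" "bs \<in> lists Basis"
  shows "partial_derivs bs (\<lambda>x. f (c *\<^sub>R x)) = (\<lambda>x. c ^ length bs * partial_derivs bs f (c *\<^sub>R x))"
    and "partial_derivs bs (\<lambda>x. f (c *\<^sub>R x)) differentiable (at x)"
proof -
  have deriv: "((\<lambda>x. a * partial_derivs cs f (c *\<^sub>R x)) has_derivative
       (\<lambda>h. a * frechet_derivative (partial_derivs cs f) (at (c *\<^sub>R x)) (c *\<^sub>R h))) (at x)"
    if "cs \<in> lists Basis" for a cs x
  proof -
    have "(partial_derivs cs f has_derivative frechet_derivative (partial_derivs cs f) (at (c *\<^sub>R x))) (at (c *\<^sub>R x))"
      using smooth_differentiable[OF assms(1) that] by (simp add: frechet_derivative_works)
    moreover have "((\<lambda>x. c *\<^sub>R x) has_derivative (\<lambda>h. c *\<^sub>R h)) (at x)"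
      by (auto intro!: derivative_eq_intros)
    ultimately show ?thesis
      by (rule has_derivative_mult_right[OF has_derivative_compose[rotated]])
  qed
  show eq: "partial_derivs bs (\<lambda>x. f (c *\<^sub>R x)) = (\<lambda>x. c ^ length bs * partial_derivs bs f (c *\<^sub>R x))"
    using assms(2)
  proof (induction bs)
    case (Cons b bs)
    have bs: "bs \<in> lists Basis" using Cons by simp
    have "linear (frechet_derivative (partial_derivs bs f) (at (c *\<^sub>R x)))" for x
      using smooth_differentiable[OF assms(1) bs] by (rule linear_frechet_derivative)
    then have "partial_deriv b (\<lambda>x. c ^ length bs * partial_derivs bs f (c *\<^sub>R x)) x
        = c ^ length (b # bs) * partial_deriv b (partial_derivs bs f) (c *\<^sub>R x)" for x
      using partial_deriv_eq[OF deriv[OF bs], of b "c ^ length bs" x]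
      by (simp add: linear_cmul partial_deriv_def[of b "partial_derivs bs f"])
    then show ?case
      using Cons.IH by (auto simp: partial_derivs_Cons)
  qed simp
  show "partial_derivs bs (\<lambda>x. f (c *\<^sub>R x)) differentiable (at x)"
    unfolding eq using deriv[OF assms(2)] by (auto simp: differentiable_def)
qed

lemma smooth_scaleR: "smooth f \<Longrightarrow> smooth (\<lambda>x. f (c *\<^sub>R x))"
  using partial_derivs_scaleR(2)[of f] by (simp add: smooth_def[of "\<lambda>x. f (c *\<^sub>R x)"])

text \<open>The squared norm keeps the argument of \<open>flat_exp\<close> polynomial, so the
  function is smooth at the centre as well. For \<rho> > 0 it is positive exactly on the open
  ball.\<close>

definition bump :: "'a::euclidean_space \<Rightarrow> real \<Rightarrow> 'a \<Rightarrow> real" where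
  "bump a \<rho> x = flat_exp 0 (\<rho>\<^sup>2 - (norm (x - a))\<^sup>2)"

lemma smooth_bump: "smooth (bump a \<rho>)"
proof -
  have "(\<lambda>x. \<Sum>b\<in>B. (x \<bullet> b - a \<bullet> b) * (x \<bullet> b - a \<bullet> b)) \<in> smooth_alg" if "finite B" for B
    using that
  proof induction
    case (insert b B)
    then show ?case
      by (auto intro!: smooth_alg.add smooth_alg.mult smooth_alg_diff smooth_alg.inner smooth_alg.const)
  qed (auto intro: smooth_alg.const)
  moreover have "(norm (x - a))\<^sup>2 = (\<Sum>b\<in>Basis. (x \<bullet> b - a \<bullet> b) * (x \<bullet> b - a \<bullet> b))" for x
    by (subst power2_norm_eq_inner, subst euclidean_inner) (simp only: inner_diff_left)
  ultimately have "(\<lambda>x. (norm (x - a))\<^sup>2) \<in> smooth_alg"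
    by simp
  then have "bump a \<rho> \<in> smooth_alg"
    unfolding bump_def by (intro smooth_alg.flat_exp smooth_alg_diff smooth_alg.const)
  then show ?thesis by (rule smooth_alg_smooth)
qed

lemma bump_nonneg: "bump a \<rho> x \<ge> 0"
  by (simp add: bump_def flat_exp_def)

lemma bump_pos: "x \<in> ball a \<rho> \<Longrightarrow> bump a \<rho> x > 0"
  by (auto simp: bump_def flat_exp_def dist_norm norm_minus_commute power2_eq_square not_le
      intro!: mult_strict_mono')

lemma bump_eq_0:
  assumes "\<rho> > 0" "x \<notin> cball a \<rho>"
  shows "bump a \<rho> x = 0"
proof -
  have "\<rho>\<^sup>2 \<le> (norm (x - a))\<^sup>2"
    using assms by (intro power_mono) (auto simp: dist_norm norm_minus_commute)
  then show ?thesis by (simp add: bump_def flat_exp_def)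
qed

lemma sector_mono: "\<delta> \<le> \<omega> \<Longrightarrow> sector \<delta> \<subseteq> sector \<omega>"
  unfolding sector_def by force

section \<open>The nonzero limit of the rescaled pairings\<close>

lemma continuous_on_power_series:
  fixes c :: "nat \<Rightarrow> real"
  assumes "\<And>t. summable (\<lambda>n. c n * t ^ n)"
  shows "continuous_on UNIV (\<lambda>t. \<Sum>n. c n * t ^ n)"
  by (intro continuous_at_imp_continuous_on ballI DERIV_isCont[OF termdiffs_strong_converges_everywhere[OF assms]])

lemma integral_pos_of_pos_on_ball:
  fixes f :: "'a::euclidean_space \<Rightarrow> real"
  assumes "integrable lborel f" "\<And>x. f x \<ge> 0" "\<And>x. x \<in> ball a \<rho> \<Longrightarrow> f x > 0" "\<rho> > 0"
  shows "integral\<^sup>L lborel f > 0"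
proof -
  have "integral\<^sup>L lborel f \<noteq> 0"
  proof
    assume "integral\<^sup>L lborel f = 0"
    then have "AE x in lborel. f x = 0"
      using assms by (simp add: integral_nonneg_eq_0_iff_AE)
    then have "AE x in lborel. \<not> x \<in> ball a \<rho>"
      by eventually_elim (use assms(3) in force)
    then have "emeasure lborel (ball a \<rho>) = 0"
      using emeasure_eq_0_AE[of "\<lambda>x. x \<in> ball a \<rho>" lborel] by (simp del: mem_ball)
    then show False using content_ball_pos[OF assms(4), of a] by (simp add: measure_def)
  qed
  moreover have "integral\<^sup>L lborel f \<ge> 0" using assms(2) by simp
  ultimately show ?thesis by linarith
qed

text \<open>Under y = k x, the \<open>M\<close> derivatives contribute k^M, the homogeneous factor
  of \<open>u\<close> contributes k^(-\<nu>), and the area element contributes k^(-2). What remains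
  is \<open>J i\<close>, in which the power series is evaluated at arguments tending to 0, so only
  \<open>c 0\<close> survives in the limit.\<close>

lemma blow_up_at_vertex:
  fixes u :: "real \<times> real \<Rightarrow> real" and c :: "nat \<Rightarrow> real" and M :: nat
  assumes \<omega>: "0 < \<omega>" "\<omega> \<le> 2 * pi" and \<nu>: "\<nu> \<notin> \<nat>"
    and c: "\<And>t. summable (\<lambda>n. c n * t ^ n)" "c 0 \<noteq> 0"
    and u: "\<And>r \<phi>. \<lbrakk>0 < r; r < 1; 0 < \<phi>; \<phi> < \<omega>\<rbrakk> \<Longrightarrow>
       u (r * cos \<phi>, r * sin \<phi>) = r powr \<nu> * (\<Sum>n. c n * (r\<^sup>2) ^ n) * cos (\<nu> * \<phi>)"
  obtains \<psi> a \<rho> J I where "smooth \<psi>" "\<rho> > 0" "cball a \<rho> \<subseteq> sector \<omega>" "\<And>x. x \<notin> cball a \<rho> \<Longrightarrow> \<psi> x = 0"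
    "I \<noteq> 0" "J \<longlonglongrightarrow> (I :: real)"
    "\<And>i. (LINT x|lebesgue_on (sector \<omega>).
            u x * partial_derivs (replicate M (1, 0)) (\<lambda>x. \<psi> (real (Suc i) *\<^sub>R x)) x)
        = real (Suc i) powr (real M - \<nu> - 2) * J i"
proof -
  \<comment> \<open>The exponent left after \<open>M\<close> integrations by parts.\<close>
  define \<beta> where "\<beta> = \<nu> - real M"
  \<comment> \<open>The bump is placed in a narrower sector on which (|\<beta>| + 1) \<phi> < pi/2.
    This forces both \<phi> < pi/2, hence the right half-plane, and cos(\<beta> \<phi>) > 0, hence
    Re (z^\<beta>) > 0.\<close>
  define \<delta> where "\<delta> = min \<omega> (pi / (2 * (\<bar>\<beta>\<bar> + 1)))"
  have \<delta>: "0 < \<delta>" "\<delta> \<le> \<omega>" "(\<bar>\<beta>\<bar> + 1) * \<delta> \<le> pi / 2"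
  proof -
    show "0 < \<delta>" "\<delta> \<le> \<omega>" using \<omega> by (auto simp: \<delta>_def)
    have "(\<bar>\<beta>\<bar> + 1) * \<delta> \<le> (\<bar>\<beta>\<bar> + 1) * (pi / (2 * (\<bar>\<beta>\<bar> + 1)))"
      by (intro mult_left_mono) (auto simp: \<delta>_def)
    also have "\<dots> = pi / 2" by (simp add: field_simps)
    finally show "(\<bar>\<beta>\<bar> + 1) * \<delta> \<le> pi / 2" .
  qed
  have angle: "\<phi> < pi / 2" "\<bar>\<beta> * \<phi>\<bar> < pi / 2" if "0 < \<phi>" "\<phi> < \<delta>" for \<phi>
  proof -
    have "(\<bar>\<beta>\<bar> + 1) * \<phi> < (\<bar>\<beta>\<bar> + 1) * \<delta>" using that by (intro mult_strict_left_mono) auto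
    then have "\<bar>\<beta>\<bar> * \<phi> + \<phi> < pi / 2" using \<delta>(3) by (simp add: distrib_right)
    moreover have "0 \<le> \<bar>\<beta>\<bar> * \<phi>" "\<bar>\<beta> * \<phi>\<bar> = \<bar>\<beta>\<bar> * \<phi>" using that by (simp_all add: abs_mult)
    ultimately show "\<phi> < pi / 2" "\<bar>\<beta> * \<phi>\<bar> < pi / 2"
      using that by linarith+
  qed
  have half_plane: "sector \<delta> \<subseteq> {p. fst p > 0}"
    using angle by (auto simp: sector_def intro!: mult_pos_pos cos_gt_zero)
  have pos: "re_powr \<beta> p > 0" if p_in: "p \<in> sector \<delta>" for p
  proof -
    obtain r \<phi> where p: "p = (r * cos \<phi>, r * sin \<phi>)" "0 < r" "0 < \<phi>" "\<phi> < \<delta>"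
      using p_in unfolding sector_def by blast
    have "cos (\<beta> * \<phi>) > 0" using angle(2)[OF p(3,4)] by (intro cos_gt_zero_pi) auto
    then show ?thesis
      using p angle(1)[OF p(3,4)] pi_gt_zero by (simp add: re_powr_polar)
  qed
  have "((1/2) * cos (\<delta>/2), (1/2) * sin (\<delta>/2)) \<in> sector \<delta>"
    unfolding sector_def mem_Collect_eq using \<delta>(1)
    by (intro exI[of _ "1/2"] exI[of _ "\<delta>/2"]) auto
  moreover have "open (sector \<delta>)" using \<delta> \<omega> by (intro open_sector) simp
  ultimately obtain a \<rho> where \<rho>: "\<rho> > 0" "cball a \<rho> \<subseteq> sector \<delta>"
    by (meson open_contains_cball)
  define S where "S = cball a \<rho>"
  define \<psi> where "\<psi> = bump a \<rho>"
  have S: "compact S" "closed S" "S \<subseteq> sector \<delta>" "S \<subseteq> {p. fst p > 0}"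
    using \<rho> half_plane by (auto simp: S_def)
  have \<psi>: "smooth \<psi>" "\<And>x. x \<notin> S \<Longrightarrow> \<psi> x = 0"
    using \<rho> by (auto simp: \<psi>_def S_def smooth_bump bump_eq_0)
  let ?bs = "replicate M (1 :: real, 0 :: real)"
  have bs: "?bs \<in> lists Basis" by (auto simp: Basis_prod_def)
  define D where "D = partial_derivs ?bs \<psi>"
  have cD: "continuous_on A D" for A
    unfolding D_def by (intro smooth_continuous_on smooth_partial_derivs \<psi> bs)
  have "closure {x. \<psi> x \<noteq> 0} \<subseteq> S"
    using S \<psi>(2) by (intro closure_minimal) auto
  then have D0: "D x = 0" if "x \<notin> S" for x
    using that closure_support_partial_derivs[of ?bs \<psi>]
      closure_subset[of "{x. D x \<noteq> 0}"] unfolding D_def by blast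
  define G where "G t = (\<Sum>n. c n * t ^ n)" for t
  have cG: "continuous_on UNIV G"
    unfolding G_def by (rule continuous_on_power_series[OF c(1)])
  have cG': "continuous_on A (\<lambda>x. G (f x))" if "continuous_on A f" for A and f :: "real \<times> real \<Rightarrow> real"
    using continuous_on_compose2[OF cG that] by simp
  have cw: "continuous_on {p. fst p > 0} (\<lambda>p. re_powr \<alpha> p)" for \<alpha>
    by (rule continuous_on_re_powr)
  \<comment> \<open>The integrand after the substitution, with the powers of \<open>k\<close> taken
    out.\<close>
  define H where "H k y = re_powr \<nu> y * G ((norm y)\<^sup>2 / k\<^sup>2) * D y" for k y
  have cH: "continuous_on UNIV (H k)" for k
    by (rule continuous_on_UNIV_glue[OF open_right_half_plane S(2,4)])
       (use D0 in \<open>auto simp: H_def divide_inverse intro!: continuous_intros cG' cD cw\<close>)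
  define J where "J i = integral\<^sup>L lborel (H (real (Suc i)))" for i
  define I where "I = c 0 * integral\<^sup>L lborel (\<lambda>y. re_powr \<nu> y * D y)"
  have cwD: "continuous_on UNIV (\<lambda>y. re_powr \<nu> y * D y)"
    by (rule continuous_on_UNIV_glue[OF open_right_half_plane S(2,4)])
       (use D0 in \<open>auto intro!: continuous_intros cD cw\<close>)
  have cwp: "continuous_on UNIV (\<lambda>y. re_powr \<beta> y * \<psi> y)"
    by (rule continuous_on_UNIV_glue[OF open_right_half_plane S(2,4)])
       (use \<psi> in \<open>auto intro!: continuous_intros smooth_continuous_on[OF \<psi>(1)] cw\<close>)
  have "integral\<^sup>L lborel (\<lambda>y. re_powr \<beta> y * \<psi> y) > 0"
  proof (rule integral_pos_of_pos_on_ball[OF _ _ _ \<rho>(1)])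
    show "integrable lborel (\<lambda>y. re_powr \<beta> y * \<psi> y)"
      by (rule integrable_compact_support[OF S(1) cwp]) (simp add: \<psi>)
    show "0 \<le> re_powr \<beta> y * \<psi> y" for y
      using pos[of y] S(3) \<psi>(2)[of y] bump_nonneg[of a \<rho> y] by (cases "y \<in> S") (auto simp: \<psi>_def less_imp_le)
    show "0 < re_powr \<beta> y * \<psi> y" if "y \<in> ball a \<rho>" for y
      unfolding \<psi>_def using \<rho>(2) that ball_subset_cball[of a \<rho>]
      by (intro mult_pos_pos pos bump_pos) blast
  qed
  \<comment> \<open>\<open>M\<close> integrations by parts turn this integral into a nonzero
    multiple of the positive integral of \<open>re_powr \<beta> y * \<psi> y\<close>.\<close>
  then have "integral\<^sup>L lborel (\<lambda>y. re_powr \<nu> y * D y) \<noteq> 0"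
    unfolding D_def \<beta>_def
    by (intro integral_re_powr_partial_derivs_nonzero[OF \<psi>(1) S(1,4) \<psi>(2) \<nu>]) auto
  then have I: "I \<noteq> 0" using c(2) by (simp add: I_def)
  have lim: "J \<longlonglongrightarrow> I"
  proof -
    \<comment> \<open>On \<open>S\<close> the argument of \<open>G\<close> stays in [0, 1], because
      \<open>S\<close> lies in the unit ball and the scale is at least 1; this yields a dominating
      function.\<close>
    have "bounded (G ` {0..1})"
      by (intro compact_imp_bounded compact_continuous_image continuous_on_subset[OF cG]) auto
    then obtain B where B: "\<And>t. t \<in> {0..1} \<Longrightarrow> \<bar>G t\<bar> \<le> B"
      unfolding bounded_pos real_norm_def by blast
    have "(\<lambda>i. integral\<^sup>L lborel (H (real (Suc i)))) \<longlonglongrightarrow> integral\<^sup>L lborel (\<lambda>y. c 0 * (re_powr \<nu> y * D y))"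
    proof (rule integral_dominated_convergence[where w = "\<lambda>y. B * \<bar>re_powr \<nu> y * D y\<bar>"])
      show "(\<lambda>y. c 0 * (re_powr \<nu> y * D y)) \<in> borel_measurable lborel"
        using borel_measurable_continuous_onI[OF cwD] by simp
      show "H (real (Suc i)) \<in> borel_measurable lborel" for i
        using borel_measurable_continuous_onI[OF cH] by simp
      show "integrable lborel (\<lambda>y. B * \<bar>re_powr \<nu> y * D y\<bar>)"
        using integrable_compact_support[OF S(1) cwD] D0 by (intro integrable_mult_right integrable_abs) auto
      have "(\<lambda>i. H (real (Suc i)) y) \<longlonglongrightarrow> c 0 * (re_powr \<nu> y * D y)" for y
      proof -
        have "(\<lambda>i. (norm y)\<^sup>2 * (inverse (real (Suc i)))\<^sup>2) \<longlonglongrightarrow> (norm y)\<^sup>2 * 0\<^sup>2"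
          by (intro tendsto_intros LIMSEQ_inverse_real_of_nat)
        then have "(\<lambda>i. (norm y)\<^sup>2 / (real (Suc i))\<^sup>2) \<longlonglongrightarrow> 0"
          by (simp add: divide_inverse power_inverse)
        moreover have "isCont G 0" using cG by (simp add: continuous_on_eq_continuous_at)
        ultimately have "(\<lambda>i. G ((norm y)\<^sup>2 / (real (Suc i))\<^sup>2)) \<longlonglongrightarrow> G 0"
          by (rule isCont_tendsto_compose[rotated])
        moreover have "G 0 = c 0" by (simp add: G_def powser_zero)
        ultimately have "(\<lambda>i. re_powr \<nu> y * G ((norm y)\<^sup>2 / (real (Suc i))\<^sup>2) * D y) \<longlonglongrightarrow> re_powr \<nu> y * c 0 * D y"
          by (intro tendsto_intros) simp
        then show ?thesis by (simp add: H_def mult_ac)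
      qed
      then show "AE y in lborel. (\<lambda>i. H (real (Suc i)) y) \<longlonglongrightarrow> c 0 * (re_powr \<nu> y * D y)" by simp
      have "norm (H (real (Suc i)) y) \<le> B * \<bar>re_powr \<nu> y * D y\<bar>" for i y
      proof (cases "y \<in> S")
        case True
        then have "norm y < 1" using S(3) sector_subset_ball[of \<delta>] by auto
        then have "(norm y)\<^sup>2 \<le> (real (Suc i))\<^sup>2" by (intro power_mono) auto
        then have "(norm y)\<^sup>2 / (real (Suc i))\<^sup>2 \<in> {0..1}"
          unfolding atLeastAtMost_iff by (intro conjI divide_le_eq_1_pos[THEN iffD2]) auto
        then have "\<bar>G ((norm y)\<^sup>2 / (real (Suc i))\<^sup>2)\<bar> * \<bar>re_powr \<nu> y * D y\<bar> \<le> B * \<bar>re_powr \<nu> y * D y\<bar>"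
          by (intro mult_right_mono B) auto
        then show ?thesis by (simp add: H_def abs_mult mult_ac)
      qed (simp add: H_def D0)
      then show "AE y in lborel. norm (H (real (Suc i)) y) \<le> B * \<bar>re_powr \<nu> y * D y\<bar>" for i by simp
    qed
    then show ?thesis by (simp add: J_def[abs_def] I_def)
  qed
  have scaled: "(LINT x|lebesgue_on (sector \<omega>). u x * partial_derivs ?bs (\<lambda>x. \<psi> (real (Suc i) *\<^sub>R x)) x)
        = real (Suc i) powr (real M - \<nu> - 2) * J i" for i
  proof -
    define k where "k = real (Suc i)"
    have k: "k \<ge> 1" "k > 0" by (auto simp: k_def)
    \<comment> \<open>On the support, x = y/k has the same angle as y. Elsewhere both sides are 0
      through the factor \<open>D\<close>.\<close>
    have pw: "u x * D (k *\<^sub>R x) = k powr - \<nu> * H k (k *\<^sub>R x)" for x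
    proof (cases "k *\<^sub>R x \<in> S")
      case True
      then obtain r \<phi> where r: "k *\<^sub>R x = (r * cos \<phi>, r * sin \<phi>)" "0 < r" "r < 1" "0 < \<phi>" "\<phi> < \<delta>"
        using S(3) by (auto simp: sector_def)
      have "x = (1 / k) *\<^sub>R (k *\<^sub>R x)" using k by simp
      then have x: "x = (r / k * cos \<phi>, r / k * sin \<phi>)" unfolding r(1) by simp
      have "u x = (r / k) powr \<nu> * G ((r / k)\<^sup>2) * cos (\<nu> * \<phi>)"
        unfolding x G_def using r \<delta> k by (intro u) (auto simp: field_simps)
      moreover have "re_powr \<nu> (k *\<^sub>R x) = r powr \<nu> * cos (\<nu> * \<phi>)"
        unfolding r(1) using r angle(1)[OF r(4,5)] pi_gt_zero by (intro re_powr_polar) linarith+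
      moreover have "norm (k *\<^sub>R x) = r" unfolding r(1) using r by (intro norm_polar) simp
      moreover have "(r / k) powr \<nu> = k powr - \<nu> * r powr \<nu>"
        using powr_divide[of r k \<nu>] r k by (simp add: powr_minus_divide)
      ultimately show ?thesis by (simp only: H_def power_divide mult_ac)
    qed (simp add: H_def D0)
    have H0: "H k (k *\<^sub>R x) = 0" if "x \<notin> sector \<omega>" for x
    proof -
      have "k *\<^sub>R x \<notin> S"
      proof
        assume "k *\<^sub>R x \<in> S"
        then have "k *\<^sub>R x \<in> sector \<omega>" using S(3) sector_mono[OF \<delta>(2)] by blast
        then have "(1 / k) *\<^sub>R (k *\<^sub>R x) \<in> sector \<omega>" by (rule scaleR_sector[rotated 2]) (use k in auto)
        with that k show False by simp
      qed
      then show ?thesis by (simp add: H_def D0)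
    qed
    have [measurable]: "H k \<in> borel_measurable borel" by (rule borel_measurable_continuous_onI[OF cH])
    have "(LINT x|lebesgue_on (sector \<omega>). u x * partial_derivs ?bs (\<lambda>x. \<psi> (k *\<^sub>R x)) x)
        = (LINT x|lebesgue_on (sector \<omega>). k ^ M * k powr - \<nu> * H k (k *\<^sub>R x))"
      unfolding partial_derivs_scaleR(1)[OF \<psi>(1) bs] D_def[symmetric]
      by (rule Bochner_Integration.integral_cong) (use pw in \<open>auto simp: mult_ac\<close>)
    also have "\<dots> = k ^ M * k powr - \<nu> * integral\<^sup>L lborel (\<lambda>x. H k (k *\<^sub>R x))"
      using H0 open_sector[OF \<omega>(2)]
      by (subst integral_mult_right_zero, subst integral_lebesgue_on_eq_lborel) auto
    also have "integral\<^sup>L lborel (\<lambda>x. H k (k *\<^sub>R x)) = J i / k ^ 2"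
    proof -
      have "J i = integral\<^sup>L lborel (H k)" by (simp only: J_def k_def)
      then show ?thesis
        using integral_lborel_scale[OF k(2), of "H k"] k by (simp add: power2_eq_square)
    qed
    also have "k ^ M * k powr - \<nu> * (J i / k ^ 2) = k powr (real M - \<nu> - 2) * J i"
      using k by (simp add: powr_diff powr_minus powr_realpow powr_numeral divide_simps)
    finally show ?thesis unfolding k_def .
  qed
  show thesis
    by (rule that[OF \<psi>(1) \<rho>(1) order_trans[OF \<rho>(2) sector_mono[OF \<delta>(2)]] \<psi>(2)[unfolded S_def] I lim scaled])
qed

subsection \<open>Decay of the pairings with rescaled bumps\<close>

lemma mem_cball_scaled_iff:
  fixes a x :: "'a::real_normed_vector"
  assumes "k > 0"
  shows "x \<in> cball ((1 / k) *\<^sub>R a) (\<rho> / k) \<longleftrightarrow> k *\<^sub>R x \<in> cball a \<rho>"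
proof -
  have "k *\<^sub>R ((1 / k) *\<^sub>R a - x) = a - k *\<^sub>R x" using assms by (simp add: scaleR_diff_right)
  then have "dist a (k *\<^sub>R x) = k * dist ((1 / k) *\<^sub>R a) x"
    using assms norm_scaleR[of k "(1 / k) *\<^sub>R a - x"] by (simp add: dist_norm)
  then show ?thesis using assms by (simp add: field_simps)
qed

text \<open>The pairing is O(1/k): the weighted inequality 2|v \<eta>| \<le>
  \<open>v\<^sup>2 / k + k * \<eta>\<^sup>2\<close> replaces Cauchy-Schwarz, and the support of the
  rescaled \<eta> has area of order k^(-2). Hence every factor k^s with s < 1 is absorbed.\<close>

lemma L2_on_scaled_bump_tendsto_0:
  fixes v \<eta> :: "real \<times> real \<Rightarrow> real"
  assumes v: "v \<in> L2_on \<Omega>" and \<Omega>: "bounded \<Omega>" "\<Omega> \<in> sets borel"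
    and \<eta>: "continuous_on UNIV \<eta>" "\<And>x. x \<notin> cball a \<rho> \<Longrightarrow> \<eta> x = 0"
    and "\<rho> > 0" "s < 1"
  shows "(\<lambda>i. real (Suc i) powr s * (LINT x|lebesgue_on \<Omega>. v x * \<eta> (real (Suc i) *\<^sub>R x))) \<longlonglongrightarrow> 0"
proof -
  interpret finite_measure "lebesgue_on \<Omega>"
    using \<Omega> by (intro finite_measure_lebesgue_on bounded_set_imp_lmeasurable) auto
  obtain B where B: "B > 0" "\<And>x. \<bar>\<eta> x\<bar> \<le> B"
    using bounded_compact_support[OF compact_cball \<eta>] by blast
  have [measurable]: "v \<in> borel_measurable (lebesgue_on \<Omega>)" and v2: "integrable (lebesgue_on \<Omega>) (\<lambda>x. (v x)\<^sup>2)"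
    using v by (auto simp: L2_on_def)
  define A where "A = (LINT x|lebesgue_on \<Omega>. (v x)\<^sup>2)"
  define C where "C = (A + B\<^sup>2 * measure lborel (cball a \<rho>)) / 2"
  have bound: "\<bar>LINT x|lebesgue_on \<Omega>. v x * \<eta> (k *\<^sub>R x)\<bar> \<le> C / k" if k: "k \<ge> 1" for k
  proof -
    let ?B = "cball ((1 / k) *\<^sub>R a) (\<rho> / k)"
    have B\<Omega>: "?B \<inter> \<Omega> \<in> sets borel" using \<Omega> by (intro sets.Int) (auto intro: borel_closed)
    then have [measurable]: "?B \<inter> \<Omega> \<in> sets (lebesgue_on \<Omega>)"
      using \<Omega>(2) by (subst sets_restrict_space_iff) simp_all
    have [measurable]: "(\<lambda>x. \<eta> (k *\<^sub>R x)) \<in> borel_measurable (lebesgue_on \<Omega>)"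
      using \<Omega> by (intro continuous_imp_measurable_on_sets_lebesgue continuous_on_compose2[OF \<eta>(1)] continuous_intros) auto
    have ind: "integrable (lebesgue_on \<Omega>) (indicator (?B \<inter> \<Omega>) :: _ \<Rightarrow> real)"
      by (rule integrable_const_bound[of _ 1]) (auto split: split_indicator)
    let ?g = "\<lambda>x. ((v x)\<^sup>2 / k + k * (B\<^sup>2 * indicator (?B \<inter> \<Omega>) x)) / 2"
    have le: "\<bar>v x * \<eta> (k *\<^sub>R x)\<bar> \<le> ?g x" if "x \<in> \<Omega>" for x
    proof (cases "x \<in> ?B")
      case True
      have "2 * (\<bar>v x\<bar> / k) * \<bar>\<eta> (k *\<^sub>R x)\<bar> \<le> (\<bar>v x\<bar> / k)\<^sup>2 + \<bar>\<eta> (k *\<^sub>R x)\<bar>\<^sup>2"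
        by (rule sum_squares_bound)
      then have "k * (2 * (\<bar>v x\<bar> / k) * \<bar>\<eta> (k *\<^sub>R x)\<bar>) \<le> k * ((\<bar>v x\<bar> / k)\<^sup>2 + \<bar>\<eta> (k *\<^sub>R x)\<bar>\<^sup>2)"
        using k by (intro mult_left_mono) auto
      moreover have "k * (2 * (\<bar>v x\<bar> / k) * \<bar>\<eta> (k *\<^sub>R x)\<bar>) = 2 * \<bar>v x * \<eta> (k *\<^sub>R x)\<bar>"
        using k by (simp add: abs_mult)
      moreover have "k * ((\<bar>v x\<bar> / k)\<^sup>2 + \<bar>\<eta> (k *\<^sub>R x)\<bar>\<^sup>2) = (v x)\<^sup>2 / k + k * \<bar>\<eta> (k *\<^sub>R x)\<bar>\<^sup>2"
        using k by (simp add: power2_eq_square field_simps)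
      moreover have "k * \<bar>\<eta> (k *\<^sub>R x)\<bar>\<^sup>2 \<le> k * B\<^sup>2"
        using k B by (intro mult_left_mono power_mono) auto
      ultimately show ?thesis using True that by (simp add: indicator_def)
    next
      case False
      then have "k *\<^sub>R x \<notin> cball a \<rho>"
        using mem_cball_scaled_iff[of k x a \<rho>] k by simp
      then have "\<eta> (k *\<^sub>R x) = 0" by (rule \<eta>(2))
      then show ?thesis using k by simp
    qed
    have ig: "integrable (lebesgue_on \<Omega>) ?g"
      using ind v2 by simp
    have "integrable (lebesgue_on \<Omega>) (\<lambda>x. v x * \<eta> (k *\<^sub>R x))"
    proof (rule Bochner_Integration.integrable_bound[OF ig])
      show "AE x in lebesgue_on \<Omega>. norm (v x * \<eta> (k *\<^sub>R x)) \<le> norm (?g x)"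
      proof (rule AE_I2)
        fix x assume "x \<in> space (lebesgue_on \<Omega>)"
        then have "\<bar>v x * \<eta> (k *\<^sub>R x)\<bar> \<le> ?g x" by (intro le) simp
        also have "?g x \<le> norm (?g x)" unfolding real_norm_def by (rule abs_ge_self)
        finally show "norm (v x * \<eta> (k *\<^sub>R x)) \<le> norm (?g x)" by (simp only: real_norm_def)
      qed
    qed measurable
    then have "norm (LINT x|lebesgue_on \<Omega>. v x * \<eta> (k *\<^sub>R x)) \<le> (LINT x|lebesgue_on \<Omega>. ?g x)"
      using ig le by (intro Bochner_Integration.integral_norm_bound_integral) auto
    also have "\<dots> = (A / k + k * (B\<^sup>2 * measure (lebesgue_on \<Omega>) (?B \<inter> \<Omega>))) / 2"
      using ind v2 by (simp add: A_def)
    also have "measure (lebesgue_on \<Omega>) (?B \<inter> \<Omega>) = measure lborel (?B \<inter> \<Omega>)"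
      using \<Omega> by (subst measure_restrict_space) auto
    also have "\<dots> \<le> measure lborel ?B"
      by (intro measure_mono_fmeasurable fmeasurableI[OF _ emeasure_compact_finite]) (use B\<Omega> in auto)
    also have "measure lborel ?B = measure lborel (cball a \<rho>) / k\<^sup>2"
      using k \<open>\<rho> > 0\<close> by (simp add: content_cball power2_eq_square)
    also have "(A / k + k * (B\<^sup>2 * (measure lborel (cball a \<rho>) / k\<^sup>2))) / 2 = C / k"
      using k by (simp add: C_def field_simps power2_eq_square)
    finally show ?thesis using k B by (simp add: mult_left_mono divide_right_mono)
  qed
  have bnd: "norm (real (Suc i) powr s * (LINT x|lebesgue_on \<Omega>. v x * \<eta> (real (Suc i) *\<^sub>R x)))
      \<le> C * real (Suc i) powr (s - 1)" for i
  proof -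
    let ?k = "real (Suc i)"
    have "?k powr s * \<bar>LINT x|lebesgue_on \<Omega>. v x * \<eta> (?k *\<^sub>R x)\<bar> \<le> ?k powr s * (C / ?k)"
      by (intro mult_left_mono bound) auto
    also have "\<dots> = C * ?k powr (s - 1)" by (simp add: powr_diff)
    finally show ?thesis by (simp add: abs_mult)
  qed
  have lim: "(\<lambda>i. C * real (Suc i) powr (s - 1)) \<longlonglongrightarrow> C * 0"
    using \<open>s < 1\<close>
    by (intro tendsto_intros tendsto_neg_powr filterlim_compose[OF filterlim_real_sequentially filterlim_Suc]) auto
  show ?thesis
    by (rule Lim_null_comparison[OF always_eventually[OF allI[OF bnd]]]) (use lim in simp)
qed

lemma (in pair_sigma_finite) integrable_integral_times:
  fixes f :: "'a \<Rightarrow> real" and g :: "'b \<Rightarrow> real"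
  assumes "integrable M1 f" "integrable M2 g"
  shows "integrable (M1 \<Otimes>\<^sub>M M2) (\<lambda>(x, y). f x * g y)"
    and "integral\<^sup>L (M1 \<Otimes>\<^sub>M M2) (\<lambda>(x, y). f x * g y) = integral\<^sup>L M1 f * integral\<^sup>L M2 g"
proof -
  have [measurable]: "f \<in> borel_measurable M1" "g \<in> borel_measurable M2" using assms by auto
  show i: "integrable (M1 \<Otimes>\<^sub>M M2) (\<lambda>(x, y). f x * g y)"
  proof (rule Fubini_integrable)
    show "integrable M1 (\<lambda>x. \<integral>y. norm (case (x, y) of (x, y) \<Rightarrow> f x * g y) \<partial>M2)"
      using assms by (simp add: abs_mult)
  qed (use assms in auto)
  show "integral\<^sup>L (M1 \<Otimes>\<^sub>M M2) (\<lambda>(x, y). f x * g y) = integral\<^sup>L M1 f * integral\<^sup>L M2 g"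
    using assms by (simp add: integral_fst'[OF i, symmetric])
qed

text \<open>
  As \<open>\<eta>\<close> has mean zero, the pairing with \<open>v\<close> is an average over \<open>y\<close> in the shrinking ball of
  pairings with \<open>v x - v y\<close>, which the energy controls. The energy of the shrinking balls tends to
  \<open>0\<close>; this is what covers the borderline order \<open>s = \<nu> + 1\<close>.
\<close>

lemma slobodeckij_scaled_bump_tendsto_0:
  fixes v \<eta> :: "real \<times> real \<Rightarrow> real"
  assumes v: "v \<in> L2_on \<Omega>" and E: "slobodeckij_energy \<sigma> \<Omega> v < \<infinity>" "\<sigma> > 0"
    and \<Omega>: "bounded \<Omega>" "\<Omega> \<in> sets borel" "0 \<notin> \<Omega>"
    and star: "\<And>t x. 0 < t \<Longrightarrow> t \<le> 1 \<Longrightarrow> x \<in> \<Omega> \<Longrightarrow> t *\<^sub>R x \<in> \<Omega>"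
    and \<eta>: "continuous_on UNIV \<eta>" "\<And>x. x \<notin> cball a \<rho> \<Longrightarrow> \<eta> x = 0" "integral\<^sup>L lborel \<eta> = 0"
    and \<rho>: "\<rho> > 0" "cball a \<rho> \<subseteq> \<Omega>"
  shows "(\<lambda>i. real (Suc i) powr (1 + \<sigma>) * (LINT x|lebesgue_on \<Omega>. v x * \<eta> (real (Suc i) *\<^sub>R x))) \<longlonglongrightarrow> 0"
proof -
  let ?M = "lebesgue_on \<Omega>"
  interpret finite_measure ?M
    using \<Omega> by (intro finite_measure_lebesgue_on bounded_set_imp_lmeasurable) auto
  interpret P: pair_sigma_finite ?M ?M ..
  let ?P = "?M \<Otimes>\<^sub>M ?M"
  obtain B where B: "B > 0" "\<And>x. \<bar>\<eta> x\<bar> \<le> B"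
    using bounded_compact_support[OF compact_cball \<eta>(1,2)] by blast
  have [measurable]: "v \<in> borel_measurable ?M" and v2: "integrable ?M (\<lambda>x. (v x)\<^sup>2)"
    using v by (auto simp: L2_on_def)
  \<comment> \<open>On a set of finite measure, L^2 embeds in L^1.\<close>
  have v1: "integrable ?M v"
  proof (rule Bochner_Integration.integrable_bound)
    show "integrable ?M (\<lambda>x. 1 + (v x)\<^sup>2)" using v2 by simp
    have "\<bar>y\<bar> \<le> \<bar>1 + y\<^sup>2\<bar>" for y :: real
    proof -
      have "2 * \<bar>y\<bar> \<le> 1 + y\<^sup>2" using sum_squares_bound[of 1 "\<bar>y\<bar>"] by simp
      then show ?thesis using zero_le_power2[of y] by linarith
    qed
    then show "AE x in ?M. norm (v x) \<le> norm (1 + (v x)\<^sup>2)" by (simp only: real_norm_def) simp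
  qed simp
  have [measurable]: "(\<lambda>x. x) \<in> ?M \<rightarrow>\<^sub>M borel"
    using id_borel_measurable_lebesgue_on[of \<Omega>] by (simp add: id_def)
  \<comment> \<open>The energy integrand as a function on the product space, where finite energy
    becomes integrability.\<close>
  define F where "F = (\<lambda>(x, y). (v x - v y)\<^sup>2 / dist x y powr (2 + 2 * \<sigma>))"
  have dist_meas [measurable]: "(\<lambda>z. dist (fst z) (snd z)) \<in> borel_measurable ?P"
    by (intro borel_measurable_dist measurable_compose[OF measurable_fst] measurable_compose[OF measurable_snd])
       measurable
  have F [measurable]: "F \<in> borel_measurable ?P"
    unfolding F_def case_prod_unfold by measurable
  have F_nonneg: "F z \<ge> 0" for z by (simp add: F_def split: prod.split)
  have iF: "integrable ?P F"
  proof (rule integrableI_nonneg)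
    have "(\<integral>\<^sup>+z. ennreal (F z) \<partial>?P) = (\<integral>\<^sup>+x. \<integral>\<^sup>+y. ennreal (F (x, y)) \<partial>?M \<partial>?M)"
      by (intro nn_integral_fst[symmetric]) simp
    also have "\<dots> = slobodeckij_energy \<sigma> \<Omega> v"
      by (simp add: slobodeckij_energy_def F_def)
    finally show "(\<integral>\<^sup>+z. ennreal (F z) \<partial>?P) < \<infinity>" using E by simp
  qed (simp_all add: F_nonneg)
  \<comment> \<open>The ball that carries the rescaled \<eta>.\<close>
  define Q where "Q k = cball ((1 / k) *\<^sub>R a) (\<rho> / k)" for k
  have Q_iff: "x \<in> Q k \<longleftrightarrow> k *\<^sub>R x \<in> cball a \<rho>" if "k > 0" for k x
    unfolding Q_def by (rule mem_cball_scaled_iff[OF that])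
  have Q_sub: "Q k \<subseteq> \<Omega>" if "k \<ge> 1" for k
  proof
    fix x assume "x \<in> Q k"
    then have "k *\<^sub>R x \<in> \<Omega>" using \<rho> that Q_iff[of k x] by auto
    then have "(1 / k) *\<^sub>R (k *\<^sub>R x) \<in> \<Omega>" by (rule star[rotated 2]) (use that in auto)
    then show "x \<in> \<Omega>" using that by simp
  qed
  have [measurable]: "Q k \<in> sets borel" for k by (simp add: Q_def)
  have mQ: "measure ?M (Q k) = measure lborel (cball a \<rho>) / k\<^sup>2" if "k \<ge> 1" for k
  proof -
    have "measure ?M (Q k) = measure lborel (Q k)"
      using Q_sub[OF that] \<Omega> by (subst measure_restrict_space) auto
    then show ?thesis using that \<rho> by (simp add: Q_def content_cball power2_eq_square)
  qed
  define m where "m = measure lborel (cball a \<rho>)"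
  have m: "m > 0" using \<rho> by (simp add: m_def content_cball_pos)
  have iQ: "integrable ?M (indicator (Q k) :: _ \<Rightarrow> real)" for k
    by (rule integrable_const_bound[of _ 1]) (auto split: split_indicator)
  have IQ: "(LINT x|?M. indicator (Q k) x) = m / k\<^sup>2" if "k \<ge> 1" for k
  proof -
    have "Q k \<inter> \<Omega> = Q k" using Q_sub[OF that] by auto
    then show ?thesis using mQ[OF that] by (simp add: m_def)
  qed
  \<comment> \<open>The part of the energy whose first point lies in the shrinking ball.\<close>
  define e where "e i = (LINT z|?P. F z * indicator (Q (real (Suc i))) (fst z))" for i
  have iFQ: "integrable ?P (\<lambda>z. F z * indicator (Q k) (fst z))" for k
    by (rule Bochner_Integration.integrable_bound[OF iF]) (auto split: split_indicator)
  have e_nonneg: "e i \<ge> 0" for i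
    unfolding e_def by (intro Bochner_Integration.integral_nonneg) (auto simp: F_nonneg)
  \<comment> \<open>Since 0 is not in \<open>\<Omega>\<close>, each fixed point eventually leaves
    the balls; dominated convergence with majorant \<open>F\<close> applies.\<close>
  have e_lim: "e \<longlonglongrightarrow> 0"
  proof -
    have "(\<lambda>i. LINT z|?P. F z * indicator (Q (real (Suc i))) (fst z)) \<longlonglongrightarrow> (LINT z|?P. 0)"
    proof (rule integral_dominated_convergence[OF _ _ iF])
      have "(\<lambda>i. F z * indicator (Q (real (Suc i))) (fst z)) \<longlonglongrightarrow> 0" if "z \<in> space ?P" for z
      proof (rule tendsto_eventually)
        have "fst z \<in> \<Omega>" using that by (auto simp: space_pair_measure)
        then have "norm (fst z) > 0" using \<Omega>(3) by auto
        then obtain n where n: "real n > (norm a + \<rho>) / norm (fst z)"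
          using reals_Archimedean2 by blast
        have "fst z \<notin> Q (real (Suc i))" if "i \<ge> n" for i
        proof
          assume "fst z \<in> Q (real (Suc i))"
          then have "dist a (real (Suc i) *\<^sub>R fst z) \<le> \<rho>" by (simp add: Q_iff del: of_nat_Suc)
          then have "norm (real (Suc i) *\<^sub>R fst z) \<le> norm a + \<rho>"
            using norm_triangle_ineq3[of "real (Suc i) *\<^sub>R fst z" a] by (simp add: dist_norm norm_minus_commute)
          then have "real (Suc i) * norm (fst z) \<le> norm a + \<rho>" by simp
          moreover have "real n * norm (fst z) > norm a + \<rho>"
            using n \<open>norm (fst z) > 0\<close> by (simp add: divide_less_eq)
          moreover have "real n * norm (fst z) \<le> real (Suc i) * norm (fst z)"
            using that by (intro mult_right_mono) auto
          ultimately show False by linarith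
        qed
        then show "\<forall>\<^sub>F i in sequentially. F z * indicator (Q (real (Suc i))) (fst z) = 0"
          unfolding eventually_sequentially by (intro exI[of _ n]) (auto split: split_indicator)
      qed
      then show "AE z in ?P. (\<lambda>i. F z * indicator (Q (real (Suc i))) (fst z)) \<longlonglongrightarrow> 0" by (intro AE_I2)
    qed (auto split: split_indicator simp: F_nonneg)
    then show ?thesis by (simp add: e_def[abs_def])
  qed
  define C where "C = (2 * \<rho>) powr (2 + 2 * \<sigma>) * m\<^sup>2"
  \<comment> \<open>The parameter \<delta> is free here and is chosen below in dependence on
    \<open>i\<close>, so that both terms on the right tend to 0.\<close>
  have bound: "k powr (1 + \<sigma>) * \<bar>LINT x|?M. v x * \<eta> (k *\<^sub>R x)\<bar> \<le> B / (2 * m) * (e i / \<delta> + C * \<delta>)"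
    if k: "k = real (Suc i)" and "\<delta> > 0" for k i \<delta>
  proof -
    have k1: "k \<ge> 1" "k > 0" using k by auto
    \<comment> \<open>the weight in the AM-GM inequality that balances both terms in their powers of \<open>k\<close>\<close>
    define t where "t = k powr - (3 + \<sigma>) / \<delta>"
    have t: "t > 0" using k1 that by (simp add: t_def)
    have \<eta>_meas [measurable]: "(\<lambda>x. \<eta> (k *\<^sub>R x)) \<in> borel_measurable ?M"
      using \<Omega> by (intro continuous_imp_measurable_on_sets_lebesgue continuous_on_compose2[OF \<eta>(1)] continuous_intros) auto
    have \<eta>0: "\<eta> (k *\<^sub>R x) = 0" if "x \<notin> Q k" for x
      using that k1 by (intro \<eta>(2)) (simp add: Q_iff)
    have i\<eta>: "integrable ?M (\<lambda>x. \<eta> (k *\<^sub>R x))"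
      using B by (intro integrable_const_bound[of _ B]) auto
    have iv\<eta>: "integrable ?M (\<lambda>x. v x * \<eta> (k *\<^sub>R x))"
    proof (rule Bochner_Integration.integrable_bound[of _ "\<lambda>x. B * v x"])
      have "norm (v x * \<eta> (k *\<^sub>R x)) \<le> norm (B * v x)" for x
        using mult_right_mono[OF B(2)[of "k *\<^sub>R x"], of "\<bar>v x\<bar>"] B(1)
        by (simp only: abs_mult real_norm_def mult.commute) (simp add: mult.commute)
      then show "AE x in ?M. norm (v x * \<eta> (k *\<^sub>R x)) \<le> norm (B * v x)" by simp
    qed (use v1 in auto)
    have ivQ: "integrable ?M (\<lambda>x. v x * indicator (Q k) x)"
      by (rule Bochner_Integration.integrable_bound[OF v1]) (auto split: split_indicator)
    have "(LINT x|?M. \<eta> (k *\<^sub>R x)) = integral\<^sup>L lborel (\<lambda>x. \<eta> (k *\<^sub>R x))"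
    proof (rule integral_lebesgue_on_eq_lborel)
      show "(\<lambda>x. \<eta> (k *\<^sub>R x)) \<in> borel_measurable borel"
        by (intro borel_measurable_continuous_onI continuous_on_compose2[OF \<eta>(1)] continuous_intros) auto
      show "\<eta> (k *\<^sub>R x) = 0" if "x \<notin> \<Omega>" for x using that Q_sub[OF k1(1)] by (intro \<eta>0) auto
    qed (rule \<Omega>)
    also have "\<dots> = 0"
      using integral_lborel_scale[OF k1(2), of \<eta>] borel_measurable_continuous_onI[OF \<eta>(1)] \<eta>(3) k1 by simp
    finally have \<eta>_mean: "(LINT x|?M. \<eta> (k *\<^sub>R x)) = 0" .
    note T1 = P.integrable_integral_times[OF iv\<eta> iQ[of k]]
    note T2 = P.integrable_integral_times[OF i\<eta> ivQ]
    \<comment> \<open>The term with \<open>v y\<close> integrates to 0 because the rescaled \<eta>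
      has mean zero; the term with \<open>v x\<close> gives the pairing times the area of
      \<open>Q k\<close>.\<close>
    let ?h = "\<lambda>(x, y). (v x - v y) * \<eta> (k *\<^sub>R x) * indicator (Q k) y"
    have h_eq: "?h = (\<lambda>z. (case z of (x, y) \<Rightarrow> v x * \<eta> (k *\<^sub>R x) * indicator (Q k) y)
        - (case z of (x, y) \<Rightarrow> \<eta> (k *\<^sub>R x) * (v y * indicator (Q k) y)))"
      by (auto simp: fun_eq_iff algebra_simps)
    have ih: "integrable ?P ?h"
      unfolding h_eq by (intro Bochner_Integration.integrable_diff T1 T2)
    have Ih: "integral\<^sup>L ?P ?h = (LINT x|?M. v x * \<eta> (k *\<^sub>R x)) * (m / k\<^sup>2)"
      unfolding h_eq Bochner_Integration.integral_diff[OF T1(1) T2(1)] T1(2) T2(2) \<eta>_mean IQ[OF k1(1)]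
      by simp
    note T3 = P.integrable_integral_times[OF iQ[of k] iQ[of k]]
    let ?g = "\<lambda>z. B / 2 * (t * (F z * indicator (Q k) (fst z)) +
        (2 * \<rho> / k) powr (2 + 2 * \<sigma>) / t * (case z of (x, y) \<Rightarrow> indicator (Q k) x * indicator (Q k) y))"
    have ig: "integrable ?P ?g"
      by (intro integrable_mult_right Bochner_Integration.integrable_add iFQ T3)
    have le: "norm (?h z) \<le> ?g z" for z
    proof (cases "fst z \<in> Q k \<and> snd z \<in> Q k")
      case True
      obtain x y where z: "z = (x, y)" by (cases z)
      with True have xy: "x \<in> Q k" "y \<in> Q k" by auto
      let ?d = "dist x y powr (2 + 2 * \<sigma>)"
      have "2 * \<bar>v x - v y\<bar> \<le> t * F (x, y) + (2 * \<rho> / k) powr (2 + 2 * \<sigma>) / t"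
      proof (cases "x = y")
        case False
        then have d: "?d > 0" by simp
        define q where "q = \<bar>v x - v y\<bar>"
        have F_q: "F (x, y) = q\<^sup>2 / ?d" by (simp add: F_def q_def)
        \<comment> \<open>Completing the square gives the AM-GM inequality with weight
          \<open>t\<close>.\<close>
        have "0 \<le> (t * q - ?d)\<^sup>2 / (t * ?d)" using t d by simp
        also have "\<dots> = t * (q\<^sup>2 / ?d) + ?d / t - 2 * q"
          using t d by (simp add: power2_eq_square divide_simps) (simp add: algebra_simps)
        finally have "2 * q \<le> t * F (x, y) + ?d / t" unfolding F_q by simp
        moreover have "dist x y \<le> 2 * \<rho> / k"
          using xy dist_triangle2[of x y "(1 / k) *\<^sub>R a"] by (simp add: Q_def dist_commute)
        then have "?d / t \<le> (2 * \<rho> / k) powr (2 + 2 * \<sigma>) / t"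
          using E t by (intro divide_right_mono powr_mono2) auto
        ultimately show ?thesis unfolding q_def by linarith
      qed (use t F_nonneg[of "(x, y)"] in simp)
      moreover have "norm (?h z) \<le> B / 2 * (2 * \<bar>v x - v y\<bar>)"
        using mult_right_mono[OF B(2)[of "k *\<^sub>R x"], of "\<bar>v x - v y\<bar>"] z xy
        by (simp add: abs_mult mult.commute)
      ultimately have "norm (?h z) \<le> B / 2 * (t * F (x, y) + (2 * \<rho> / k) powr (2 + 2 * \<sigma>) / t)"
        using B(1) mult_left_mono[of "2 * \<bar>v x - v y\<bar>" _ "B / 2"] by (meson less_imp_le half_gt_zero order_trans)
      then show ?thesis using xy z by simp
    next
      case False
      then have "?h z = 0" using \<eta>0[of "fst z"] by (auto split: prod.split)
      moreover have "?g z \<ge> 0" using B t F_nonneg[of z] by (auto split: prod.split)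
      ultimately show ?thesis by simp
    qed
    have "norm (integral\<^sup>L ?P ?h) \<le> integral\<^sup>L ?P ?g"
      by (rule Bochner_Integration.integral_norm_bound_integral[OF ih ig]) (rule le)
    also have "\<dots> = B / 2 * (t * e i + (2 * \<rho> / k) powr (2 + 2 * \<sigma>) / t * ((m / k\<^sup>2) * (m / k\<^sup>2)))"
      using iFQ[of k] T3 IQ[OF k1(1)] by (simp add: e_def k del: of_nat_Suc)
    finally have "\<bar>LINT x|?M. v x * \<eta> (k *\<^sub>R x)\<bar> * (m / k\<^sup>2)
       \<le> B / 2 * (t * e i + (2 * \<rho> / k) powr (2 + 2 * \<sigma>) / t * ((m / k\<^sup>2) * (m / k\<^sup>2)))"
      using m by (simp add: Ih abs_mult)
    \<comment> \<open>The new factor cancels the area m/k^2 on the left and leaves k^(1+\<sigma>)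
      times the pairing.\<close>
    then have "\<bar>LINT x|?M. v x * \<eta> (k *\<^sub>R x)\<bar> * (m / k\<^sup>2) * (k powr (3 + \<sigma>) / m)
       \<le> B / 2 * (t * e i + (2 * \<rho> / k) powr (2 + 2 * \<sigma>) / t * ((m / k\<^sup>2) * (m / k\<^sup>2))) * (k powr (3 + \<sigma>) / m)"
      using m by (intro mult_right_mono) auto
    also have "\<bar>LINT x|?M. v x * \<eta> (k *\<^sub>R x)\<bar> * (m / k\<^sup>2) * (k powr (3 + \<sigma>) / m)
        = k powr (1 + \<sigma>) * \<bar>LINT x|?M. v x * \<eta> (k *\<^sub>R x)\<bar>"
    proof -
      have "k powr (3 + \<sigma>) = k powr (1 + \<sigma>) * k\<^sup>2"
        using k1 powr_add[of k "1 + \<sigma>" 2] by (simp add: powr_numeral)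
      then show ?thesis using m k1 by simp
    qed
    also have "B / 2 * (t * e i + (2 * \<rho> / k) powr (2 + 2 * \<sigma>) / t * ((m / k\<^sup>2) * (m / k\<^sup>2))) * (k powr (3 + \<sigma>) / m)
        = B / (2 * m) * (e i / \<delta> + C * \<delta>)"
    proof -
      define K where "K = k powr (1 + \<sigma>)"
      have K: "K > 0" using k1 by (simp add: K_def)
      have K3: "k powr (3 + \<sigma>) = K * k\<^sup>2"
        using k1 powr_add[of k "1 + \<sigma>" 2] by (simp add: powr_numeral K_def)
      have K2: "(2 * \<rho> / k) powr (2 + 2 * \<sigma>) = (2 * \<rho>) powr (2 + 2 * \<sigma>) / K\<^sup>2"
        using \<rho> k1 powr_add[of k "1 + \<sigma>" "1 + \<sigma>"] by (simp add: powr_divide K_def power2_eq_square)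
      have tK: "t = 1 / (K * k\<^sup>2 * \<delta>)"
        unfolding t_def powr_minus_divide K3 by simp
      show ?thesis
        unfolding K2 K3 tK C_def using m K k1 \<open>\<delta> > 0\<close>
        by (simp add: field_simps power2_eq_square)
    qed
    finally show ?thesis .
  qed
  \<comment> \<open>The square root makes \<open>e i / \<delta> i\<close> at most
    \<open>sqrt (e i)\<close>; the added null sequence keeps \<open>\<delta> i\<close> positive when
    \<open>e i\<close> is 0.\<close>
  define \<delta> where "\<delta> i = sqrt (e i) + inverse (real (Suc i))" for i
  have \<delta>: "\<delta> i > 0" for i using e_nonneg[of i] by (simp add: \<delta>_def add_nonneg_pos)
  have bnd: "norm (real (Suc i) powr (1 + \<sigma>) * (LINT x|?M. v x * \<eta> (real (Suc i) *\<^sub>R x)))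
      \<le> B / (2 * m) * (sqrt (e i) + C * \<delta> i)" for i
  proof -
    have "sqrt (e i) * sqrt (e i) \<le> sqrt (e i) * \<delta> i"
      by (intro mult_left_mono) (auto simp: \<delta>_def e_nonneg)
    then have "e i / \<delta> i \<le> sqrt (e i)"
      using \<delta>[of i] e_nonneg[of i] by (simp add: divide_le_eq)
    then have "B / (2 * m) * (e i / \<delta> i + C * \<delta> i) \<le> B / (2 * m) * (sqrt (e i) + C * \<delta> i)"
      using B m by (intro mult_left_mono) auto
    with bound[OF refl \<delta>, of i i] show ?thesis by (simp add: abs_mult del: of_nat_Suc)
  qed
  have lim: "(\<lambda>i. B / (2 * m) * (sqrt (e i) + C * \<delta> i)) \<longlonglongrightarrow> B / (2 * m) * (sqrt 0 + C * (sqrt 0 + 0))"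
    unfolding \<delta>_def by (intro tendsto_intros e_lim LIMSEQ_inverse_real_of_nat)
  show ?thesis
    by (rule Lim_null_comparison[OF always_eventually[OF allI[OF bnd]]]) (use lim in simp)
qed

subsection \<open>Sharpness\<close>

lemma zero_notin_sector: "0 \<notin> sector \<omega>"
proof
  assume "0 \<in> sector \<omega>"
  then obtain r \<phi> :: real where "0 = (r * cos \<phi>, r * sin \<phi>)" "0 < r"
    unfolding sector_def by blast
  then show False using norm_polar[of r \<phi>] by simp
qed

text \<open>Membership forces \<open>J\<close> to tend to 0 instead of \<open>I\<close>. If the
  integer part of \<open>s\<close> is at least N + 2, an L^2 derivative of that order suffices.
  Otherwise it equals N + 1, and the energy of a derivative of order N + 1 is used.\<close>

lemma not_in_sobolev_slobodeckij_bessel: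
  fixes u :: "real \<times> real \<Rightarrow> real" and c :: "nat \<Rightarrow> real"
  assumes \<omega>: "0 < \<omega>" "\<omega> \<le> 2 * pi" and \<nu>: "\<nu> \<notin> \<nat>" "\<nu> \<ge> 0"
    and c: "\<And>t. summable (\<lambda>n. c n * t ^ n)" "c 0 \<noteq> 0"
    and u: "\<And>r \<phi>. \<lbrakk>0 < r; r < 1; 0 < \<phi>; \<phi> < \<omega>\<rbrakk> \<Longrightarrow>
       u (r * cos \<phi>, r * sin \<phi>) = r powr \<nu> * (\<Sum>n. c n * (r\<^sup>2) ^ n) * cos (\<nu> * \<phi>)"
    and s: "s \<ge> \<nu> + 1"
  shows "u \<notin> sobolev_slobodeckij s (sector \<omega>)"
proof
  assume mem: "u \<in> sobolev_slobodeckij s (sector \<omega>)"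
  define \<Omega> where "\<Omega> = sector \<omega>"
  define N where "N = nat \<lfloor>\<nu>\<rfloor>"
  \<comment> \<open>With this order the scaling exponent \<open>real M - \<nu> - 2\<close> equals N
    - \<nu>, so \<open>J i\<close> is k^(\<nu>-N) times the pairing, where 0 < \<nu> - N <
    1.\<close>
  define M where "M = N + 2"
  let ?e = "(1, 0) :: real \<times> real"
  let ?bs = "\<lambda>n. replicate n ?e"
  have N: "real N < \<nu>" "\<nu> < real N + 1"
  proof -
    have "real N \<le> \<nu>" "\<nu> < real N + 1" using \<nu>(2) by (auto simp: N_def of_nat_nat)
    moreover have "real N \<noteq> \<nu>" using \<nu>(1) by auto
    ultimately show "real N < \<nu>" "\<nu> < real N + 1" by auto
  qed
  have bs: "?bs n \<in> lists Basis" for n by (auto simp: Basis_prod_def)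
  have \<Omega>: "open \<Omega>" "bounded \<Omega>" "\<Omega> \<in> sets borel" "0 \<notin> \<Omega>"
    using open_sector[OF \<omega>(2)] bounded_sector zero_notin_sector by (auto simp: \<Omega>_def)
  obtain \<psi> a \<rho> J I where \<psi>: "smooth \<psi>" and \<rho>: "\<rho> > 0" "cball a \<rho> \<subseteq> \<Omega>"
    and \<psi>0: "\<And>x. x \<notin> cball a \<rho> \<Longrightarrow> \<psi> x = 0" and I: "I \<noteq> 0" "J \<longlonglongrightarrow> (I :: real)"
    and J: "\<And>i. (LINT x|lebesgue_on \<Omega>. u x * partial_derivs (?bs M) (\<lambda>x. \<psi> (real (Suc i) *\<^sub>R x)) x)
        = real (Suc i) powr (real M - \<nu> - 2) * J i"
  proof (rule blow_up_at_vertex[OF \<omega> \<nu>(1) c, of u M, folded \<Omega>_def], goal_cases)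
    case (1 r \<phi>)
    show ?case by (rule u[OF 1(2-5)])
  next
    case (2 \<psi> \<rho> a J I)
    show ?case by (rule 2(1)[OF 2(2-8)])
  qed
  \<comment> \<open>The support is the ball shrunk by 1/k towards the vertex, which stays in the
    sector.\<close>
  have test: "(\<lambda>x. \<psi> (k *\<^sub>R x)) \<in> test_functions \<Omega>" if k: "k \<ge> 1" for k
  proof -
    let ?Q = "cball ((1 / k) *\<^sub>R a) (\<rho> / k)"
    have "{x. \<psi> (k *\<^sub>R x) \<noteq> 0} \<subseteq> ?Q"
    proof
      fix x assume "x \<in> {x. \<psi> (k *\<^sub>R x) \<noteq> 0}"
      then have "k *\<^sub>R x \<in> cball a \<rho>" using \<psi>0[of "k *\<^sub>R x"] by blast
      then show "x \<in> ?Q" using mem_cball_scaled_iff[of k x a \<rho>] k by simp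
    qed
    then have cl: "closure {x. \<psi> (k *\<^sub>R x) \<noteq> 0} \<subseteq> ?Q" by (intro closure_minimal) auto
    moreover have "?Q \<subseteq> \<Omega>"
    proof
      fix x assume "x \<in> ?Q"
      then have "k *\<^sub>R x \<in> \<Omega>" using mem_cball_scaled_iff[of k x a \<rho>] k \<rho>(2) by auto
      then have "(1 / k) *\<^sub>R (k *\<^sub>R x) \<in> \<Omega>"
        unfolding \<Omega>_def by (rule scaleR_sector[rotated 2]) (use k in auto)
      then show "x \<in> \<Omega>" using k by simp
    qed
    moreover have "compact (closure {x. \<psi> (k *\<^sub>R x) \<noteq> 0})"
      using bounded_subset[OF bounded_cball cl] by (simp add: compact_eq_bounded_closed)
    ultimately show ?thesis
      using smooth_scaleR[OF \<psi>, of k] by (auto simp: test_functions_def)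
  qed
  have sob: "u \<in> sobolev (nat \<lfloor>s\<rfloor>) \<Omega>" using mem by (simp add: sobolev_slobodeckij_def \<Omega>_def)
  have "J \<longlonglongrightarrow> 0"
  proof (cases "\<lfloor>s\<rfloor> \<ge> int M")
    case True
    then have "length (?bs M) \<le> nat \<lfloor>s\<rfloor>" by simp
    with sob bs obtain v where v: "v \<in> L2_on \<Omega>" "is_weak_deriv \<Omega> (?bs M) u v"
      unfolding sobolev_def by blast
    have "real (Suc i) powr (\<nu> - N) * (LINT x|lebesgue_on \<Omega>. v x * \<psi> (real (Suc i) *\<^sub>R x))
       = (-1) ^ M * J i" for i
    proof -
      let ?k = "real (Suc i)"
      have "?k powr (real M - \<nu> - 2) * J i = (-1) ^ M * (LINT x|lebesgue_on \<Omega>. v x * \<psi> (?k *\<^sub>R x))"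
        using v(2) test[of ?k] J[of i] unfolding is_weak_deriv_def by simp
      then have "?k powr (\<nu> - N) * (?k powr (real M - \<nu> - 2) * J i)
          = (-1) ^ M * (?k powr (\<nu> - N) * (LINT x|lebesgue_on \<Omega>. v x * \<psi> (?k *\<^sub>R x)))"
        by (simp only: mult_ac)
      moreover have "?k powr (\<nu> - N) * ?k powr (real M - \<nu> - 2) = 1"
        unfolding powr_add[symmetric] by (simp add: M_def)
      ultimately have "J i = (-1) ^ M * (?k powr (\<nu> - N) * (LINT x|lebesgue_on \<Omega>. v x * \<psi> (?k *\<^sub>R x)))"
        by (metis mult.assoc mult_1)
      then show ?thesis by (simp flip: mult.assoc power_add)
    qed
    moreover have "(\<lambda>i. real (Suc i) powr (\<nu> - N) * (LINT x|lebesgue_on \<Omega>. v x * \<psi> (real (Suc i) *\<^sub>R x))) \<longlonglongrightarrow> 0"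
      by (rule L2_on_scaled_bump_tendsto_0[OF v(1) \<Omega>(2,3) smooth_continuous_on[OF \<psi>] \<psi>0 \<rho>(1)]) (use N in auto)
    ultimately have "(\<lambda>i. (-1) ^ M * J i) \<longlonglongrightarrow> 0" by simp
    then have "(\<lambda>i. \<bar>(-1) ^ M * J i\<bar>) \<longlonglongrightarrow> 0" by (rule tendsto_rabs_zero)
    then show ?thesis by (simp add: abs_mult tendsto_rabs_zero_iff)
  next
    case False
    then have fl: "\<lfloor>s\<rfloor> = int N + 1" using s N by (simp add: M_def) linarith
    define \<sigma> where "\<sigma> = s - of_int \<lfloor>s\<rfloor>"
    \<comment> \<open>The fractional part is at least \<nu> - N > 0, so \<open>s\<close> is not a
      natural number and the energy clause of the space is in force.\<close>
    have \<sigma>: "\<sigma> \<ge> \<nu> - N" "\<sigma> > 0" using s N by (auto simp: \<sigma>_def fl)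
    have "s \<notin> \<nat>"
      using \<sigma> by (auto simp: \<sigma>_def elim!: Nats_cases)
    moreover have "nat \<lfloor>s\<rfloor> = N + 1" using fl by simp
    ultimately obtain v where v: "v \<in> L2_on \<Omega>" "is_weak_deriv \<Omega> (?bs (N + 1)) u v"
        "slobodeckij_energy \<sigma> \<Omega> v < \<infinity>"
      using mem bs[of "N + 1"] unfolding sobolev_slobodeckij_def \<Omega>_def \<sigma>_def by force
    define \<eta> where "\<eta> = partial_deriv ?e \<psi>"
    have e: "[?e] \<in> lists Basis" using bs[of 1] by simp
    have \<eta>: "smooth \<eta>" using smooth_partial_derivs[OF \<psi> e] by (simp add: \<eta>_def partial_derivs_Cons)
    have "{x. \<psi> x \<noteq> 0} \<subseteq> cball a \<rho>" using \<psi>0 by blast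
    then have "closure {x. \<psi> x \<noteq> 0} \<subseteq> cball a \<rho>" by (rule closure_minimal[OF _ closed_cball])
    then have \<eta>0: "\<eta> x = 0" if "x \<notin> cball a \<rho>" for x
      using that unfolding \<eta>_def by (intro partial_deriv_eq_0) blast
    have mean: "integral\<^sup>L lborel \<eta> = 0"
      unfolding \<eta>_def
      by (rule integral_partial_deriv_eq_0[OF _ smooth_continuous_on[OF \<eta>[unfolded \<eta>_def]] compact_cball \<psi>0])
         (use smooth_differentiable[OF \<psi>, of "[]"] in auto)
    have "real (Suc i) powr (\<nu> - N + 1) * (LINT x|lebesgue_on \<Omega>. v x * \<eta> (real (Suc i) *\<^sub>R x))
       = (-1) ^ (N + 1) * J i" for i
    proof -
      let ?k = "real (Suc i)"
      let ?L = "LINT x|lebesgue_on \<Omega>. v x * \<eta> (?k *\<^sub>R x)"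
      \<comment> \<open>The innermost of the N + 2 derivatives stays on the bump, which makes the
        test function mean-zero; the weak derivative takes the other N + 1. The chain rule
        contributes the extra factor k.\<close>
      define \<theta> where "\<theta> = partial_derivs [?e] (\<lambda>x. \<psi> (?k *\<^sub>R x))"
      have \<theta>: "\<theta> \<in> test_functions \<Omega>"
        unfolding \<theta>_def by (rule test_functions_partial_derivs[OF test e]) simp
      have \<theta>_eq: "\<theta> = (\<lambda>x. ?k * \<eta> (?k *\<^sub>R x))"
        unfolding \<theta>_def partial_derivs_scaleR(1)[OF \<psi> e] by (simp add: \<eta>_def partial_derivs_Cons)
      have "?bs M = ?bs (N + 1) @ [?e]" by (simp add: M_def replicate_append_same)
      then have "partial_derivs (?bs M) (\<lambda>x. \<psi> (?k *\<^sub>R x)) = partial_derivs (?bs (N + 1)) \<theta>"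
        by (simp only: partial_derivs_append \<theta>_def)
      then have "?k powr (real M - \<nu> - 2) * J i = (-1) ^ (N + 1) * (LINT x|lebesgue_on \<Omega>. v x * \<theta> x)"
        using v(2) \<theta> J[of i] unfolding is_weak_deriv_def by simp
      also have "(LINT x|lebesgue_on \<Omega>. v x * \<theta> x) = ?k * ?L"
        unfolding \<theta>_eq by (subst integral_mult_right_zero[symmetric]) (simp only: mult_ac)
      finally have "?k powr (\<nu> - N) * (?k powr (real M - \<nu> - 2) * J i)
          = (-1) ^ (N + 1) * ((?k powr (\<nu> - N) * ?k) * ?L)"
        by (simp only: mult_ac)
      moreover have "?k powr (\<nu> - N) * ?k powr (real M - \<nu> - 2) = 1"
        unfolding powr_add[symmetric] by (simp add: M_def)
      moreover have "?k powr (\<nu> - N) * ?k = ?k powr (\<nu> - N + 1)"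
        unfolding powr_add by simp
      ultimately have "J i = (-1) ^ (N + 1) * (?k powr (\<nu> - N + 1) * ?L)"
        by (metis mult.assoc mult_1)
      then show ?thesis by (simp flip: mult.assoc power_add)
    qed
    then have "\<bar>J i\<bar> = \<bar>real (Suc i) powr (\<nu> - N + 1) * (LINT x|lebesgue_on \<Omega>. v x * \<eta> (real (Suc i) *\<^sub>R x))\<bar>" for i
      by (simp add: abs_mult)
    \<comment> \<open>The base is at least 1 and \<nu> - N \<le> \<sigma>. In the borderline case s
      = \<nu> + 1 the exponents coincide.\<close>
    moreover have "\<bar>real (Suc i) powr (\<nu> - N + 1) * (LINT x|lebesgue_on \<Omega>. v x * \<eta> (real (Suc i) *\<^sub>R x))\<bar>
        \<le> \<bar>real (Suc i) powr (1 + \<sigma>) * (LINT x|lebesgue_on \<Omega>. v x * \<eta> (real (Suc i) *\<^sub>R x))\<bar>" for i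
      unfolding abs_mult using \<sigma> by (intro mult_right_mono) (auto intro!: powr_mono)
    ultimately have bnd: "norm (J i) \<le> \<bar>real (Suc i) powr (1 + \<sigma>) * (LINT x|lebesgue_on \<Omega>. v x * \<eta> (real (Suc i) *\<^sub>R x))\<bar>" for i
      by (simp only: real_norm_def)
    have lim: "(\<lambda>i. real (Suc i) powr (1 + \<sigma>) * (LINT x|lebesgue_on \<Omega>. v x * \<eta> (real (Suc i) *\<^sub>R x))) \<longlonglongrightarrow> 0"
      by (rule slobodeckij_scaled_bump_tendsto_0[OF v(1,3) \<sigma>(2) \<Omega>(2-4) _ smooth_continuous_on[OF \<eta>] \<eta>0 mean \<rho>])
         (auto simp: \<Omega>_def intro: scaleR_sector)
    show ?thesis
      by (rule Lim_null_comparison[OF always_eventually[OF allI[OF bnd]] tendsto_rabs_zero[OF lim]])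
  qed
  with I show False using LIMSEQ_unique by blast
qed

theorem lemma2:
  fixes \<omega> \<nu> \<mu> :: real and k m :: nat and u :: "real \<times> real \<Rightarrow> real"
  assumes "0 < \<omega>" and "\<omega> \<le> 2 * pi"
    and "m \<ge> 1"
    and "\<nu> = real k * (pi / \<omega>)"
    and "is_nth_positive_root (bessel_J \<nu>) m \<mu>"
    and "\<And>r \<phi>. \<lbrakk>0 < r; r < 1; 0 < \<phi>; \<phi> < \<omega>\<rbrakk> \<Longrightarrow>
           u (r * cos \<phi>, r * sin \<phi>) = bessel_J \<nu> (\<mu> * r) * cos (\<nu> * \<phi>)"
  shows "((\<forall>s\<ge>0. u \<in> sobolev_slobodeckij s (sector \<omega>)) \<longleftrightarrow> \<nu> \<in> \<nat>) \<and>
         (\<nu> \<notin> \<nat> \<longrightarrow> (\<forall>s\<ge>\<nu> + 1. u \<notin> sobolev_slobodeckij s (sector \<omega>)))"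
proof -
  have \<mu>: "\<mu> > 0" using assms(5) by (simp add: is_nth_positive_root_def)
  have \<nu>: "\<nu> \<ge> 0" using assms(1,4) by simp
  have "u \<in> sobolev_slobodeckij s (sector \<omega>)" if nat: "\<nu> \<in> \<nat>" and "s \<ge> 0" for s
  proof -
    obtain n where "\<nu> = real n" using nat by (elim Nats_cases)
    then show ?thesis
      using assms(6) by (intro sobolev_slobodeckij_bessel_nat[OF assms(2) \<mu> that(2), of u n]) simp
  qed
  moreover have "u \<notin> sobolev_slobodeckij s (sector \<omega>)" if "\<nu> \<notin> \<nat>" "s \<ge> \<nu> + 1" for s
  proof -
    obtain c where c: "\<And>t. summable (\<lambda>n. c n * t ^ n)" "c 0 \<noteq> 0"
      "\<And>r. r > 0 \<Longrightarrow> bessel_J \<nu> (\<mu> * r) = r powr \<nu> * (\<Sum>n. c n * (r\<^sup>2) ^ n)"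
      using bessel_J_scaled_power_series[OF \<nu> \<mu>] by blast
    show ?thesis
      by (rule not_in_sobolev_slobodeckij_bessel[OF assms(1,2) that(1) \<nu> c(1,2) _ that(2)])
         (simp add: assms(6) c(3))
  qed
  \<comment> \<open>For \<nu> not a natural number, the order s = \<nu> + 1 already violates
    membership for all \<open>s\<close>, which gives the remaining direction of the
    equivalence.\<close>
  ultimately show ?thesis
    using \<nu> by (meson add_nonneg_nonneg order_refl zero_le_one)
qed

end
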